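(* The kernel $K(\mathcal{V},\mathcal{W})=(-q)^{-k(\mathcal{V},\mathcal{W})}$ on $\mathrm{Fl}(2\infty)\times\mathrm{Fl}(2\infty)$ is positive definite, i.e., for any finite collection of points $\mathcal{V}_i\in\mathrm{Fl}(2\infty)$ one has $\det_{i,j}\{K(\mathcal{V}_i,\mathcal{V}_j)\}\geq 0$.
   Context: $\mathbb{F}_q$ is the field with $q$ elements. $L$ is the $\mathbb{F}_q$-linear space of two-sided sequences $x=(\dots,x_{-1},x_0,x_1,\dots)$ with $x_k\in\mathbb{F}_q$ such that $x_k=0$ for all sufficiently large $k$. For $j\in\mathbb{Z}$, $E_j\subset L$ is the subspace of vectors of the form $(\dots,x_{j-1},x_j,0,0,\dots)$, i.e. $x_k=0$ for $k>j$; the chain $\dots\subset E_{-1}\subset E_0\subset E_1\subset\dots$ is the standard flag $\mathcal{E}$. $\mathrm{Fl}(2\infty)$ is the space of complete flags coinciding with the standard flag in all but finitely many terms: its elements are the families $\mathcal{V}=(V_j)_{j\in\mathbb{Z}}$ of subspaces of $L$ for which there exist integers $M\leq N$ such that $V_j=E_j$ for $j\leq M$ and for $j\geq N$, and such that for some complete flag $0=F_0\subset F_1\subset\dots\subset F_{N-M}=E_N/E_M$ (with $\dim F_\alpha=\alpha$) in the finite-dimensional space $E_N/E_M$, the subspace $V_{M+\alpha}$ is the preimage of $F_\alpha$ under the projection $E_N\to E_N/E_M$ for all $0\leq\alpha\leq N-M$. For $\mathcal{V},\mathcal{W}\in\mathrm{Fl}(2\infty)$, $k(\mathcal{V},\mathcal{W})$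 is the (finite) number of pairs $(i,j)\in\mathbb{Z}\times\mathbb{Z}$ such that $V_{i+1}\cap W_{j+1}=V_i\cap W_j$. *)

theory Defs
  imports "Jordan_Normal_Form.VS_Connect" "HOL-Algebra.QuotRing"
    "HOL-Library.Cardinality"
begin

section \<open>Quotients of vector spaces\<close>

text \<open>
  The quotient \<open>V/U\<close> is the set of cosets \<open>U + x\<close>, with the additive structure that
  \<^const>\<open>FactRing\<close> uses. The fields \<open>mult\<close> and \<open>one\<close> of a module record play no role.
\<close>

definition quotient_space :: "('a, 'b, 'm) module_scheme \<Rightarrow> 'b set \<Rightarrow> ('a, 'b set) module"
  where "quotient_space V U =
    \<lparr>carrier = a_rcosets\<^bsub>V\<^esub> U, mult = undefined, one = undefined,
     zero = U, add = set_add V,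
     smult = (\<lambda>c X. \<Union>x\<in>X. U +>\<^bsub>V\<^esub> (c \<odot>\<^bsub>V\<^esub> x))\<rparr>"

lemma quotient_space_vectorspace:
  assumes V: "vectorspace K V" and U: "subspace K U V"
  shows "vectorspace K (quotient_space V U)"
proof -
  interpret V: vectorspace K V by (rule V)
  have U_sub: "U \<subseteq> carrier V" and U_zero: "\<zero>\<^bsub>V\<^esub> \<in> U"
    and U_smult: "\<And>c u. c \<in> carrier K \<Longrightarrow> u \<in> U \<Longrightarrow> c \<odot>\<^bsub>V\<^esub> u \<in> U"
    and U_add: "\<And>u v. u \<in> U \<Longrightarrow> v \<in> U \<Longrightarrow> u \<oplus>\<^bsub>V\<^esub> v \<in> U"
    using U unfolding subspace_def submodule_def by auto
  have U_neg: "\<ominus>\<^bsub>V\<^esub> u \<in> U" if "u \<in> U" for u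
  proof -
    have "(\<ominus>\<^bsub>K\<^esub> \<one>\<^bsub>K\<^esub>) \<odot>\<^bsub>V\<^esub> u \<in> U" using that by (intro U_smult) auto
    moreover have "(\<ominus>\<^bsub>K\<^esub> \<one>\<^bsub>K\<^esub>) \<odot>\<^bsub>V\<^esub> u = \<ominus>\<^bsub>V\<^esub> u"
      using that U_sub by (subst V.smult_l_minus) auto
    ultimately show ?thesis by simp
  qed
  have "additive_subgroup U V"
    using U_sub U_zero U_add U_neg
    by (intro additive_subgroup.intro subgroup.intro)
       (auto simp: a_inv_def[symmetric])
  then interpret U: abelian_subgroup U V
    by (intro abelian_subgroupI3 V.abelian_group_axioms)
  let ?Q = "quotient_space V U"
  have car: "carrier ?Q = {U +>\<^bsub>V\<^esub> x | x. x \<in> carrier V}"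
    by (auto simp: quotient_space_def A_RCOSETS_def RCOSETS_def a_r_coset_def)
  have in_car: "U +>\<^bsub>V\<^esub> x \<in> carrier ?Q" if "x \<in> carrier V" for x
    using that car by auto
  have add: "(U +>\<^bsub>V\<^esub> x) \<oplus>\<^bsub>?Q\<^esub> (U +>\<^bsub>V\<^esub> y) = U +>\<^bsub>V\<^esub> (x \<oplus>\<^bsub>V\<^esub> y)"
    if "x \<in> carrier V" "y \<in> carrier V" for x y
    using that by (simp add: quotient_space_def U.a_rcos_sum)
  have smult: "c \<odot>\<^bsub>?Q\<^esub> (U +>\<^bsub>V\<^esub> x) = U +>\<^bsub>V\<^esub> (c \<odot>\<^bsub>V\<^esub> x)"
    if c: "c \<in> carrier K" and x: "x \<in> carrier V" for c x
  proof -
    have *: "U +>\<^bsub>V\<^esub> (c \<odot>\<^bsub>V\<^esub> y) = U +>\<^bsub>V\<^esub> (c \<odot>\<^bsub>V\<^esub> x)" if y: "y \<in> U +>\<^bsub>V\<^esub> x" for y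
    proof -
      obtain u where u: "u \<in> U" "y = u \<oplus>\<^bsub>V\<^esub> x"
        using y by (auto simp: a_r_coset_def')
      have "c \<odot>\<^bsub>V\<^esub> y = c \<odot>\<^bsub>V\<^esub> u \<oplus>\<^bsub>V\<^esub> c \<odot>\<^bsub>V\<^esub> x"
        using u c x U_sub by (auto simp: V.smult_r_distr)
      then have "c \<odot>\<^bsub>V\<^esub> y \<in> U +>\<^bsub>V\<^esub> (c \<odot>\<^bsub>V\<^esub> x)"
        using U_smult[OF c u(1)] by (auto simp: a_r_coset_def')
      then show ?thesis using c x by (metis U.a_repr_independence' V.smult_closed)
    qed
    have "x \<in> U +>\<^bsub>V\<^esub> x" using x U_zero by (force simp: a_r_coset_def')
    then have "(\<Union>y\<in>U +>\<^bsub>V\<^esub> x. U +>\<^bsub>V\<^esub> (c \<odot>\<^bsub>V\<^esub> y)) = U +>\<^bsub>V\<^esub> (c \<odot>\<^bsub>V\<^esub> x)"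
      using * by blast
    then show ?thesis by (simp add: quotient_space_def)
  qed
  have zero: "\<zero>\<^bsub>?Q\<^esub> = U +>\<^bsub>V\<^esub> \<zero>\<^bsub>V\<^esub>"
    by (simp add: quotient_space_def U_sub)
  have grp: "abelian_group ?Q"
  proof (rule abelian_groupI)
    fix X assume "X \<in> carrier ?Q"
    then obtain x where x: "x \<in> carrier V" "X = U +>\<^bsub>V\<^esub> x" using car by auto
    then show "\<exists>Y\<in>carrier ?Q. Y \<oplus>\<^bsub>?Q\<^esub> X = \<zero>\<^bsub>?Q\<^esub>"
      by (intro bexI[of _ "U +>\<^bsub>V\<^esub> (\<ominus>\<^bsub>V\<^esub> x)"]) (auto simp: add zero in_car V.l_neg)
  next
    fix X Y assume "X \<in> carrier ?Q" "Y \<in> carrier ?Q"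
    then show "X \<oplus>\<^bsub>?Q\<^esub> Y = Y \<oplus>\<^bsub>?Q\<^esub> X"
      by (auto simp: car add V.a_comm)
  qed (auto simp: car add zero V.a_assoc)
  have "module K ?Q"
    by (intro Module.module.intro module_axioms.intro grp V.is_cring)
       (auto simp: car add smult V.smult_l_distr V.smult_r_distr V.smult_assoc1)
  then show ?thesis
    unfolding vectorspace_def using V.field_axioms by auto
qed


section \<open>Sequences, the standard flag and the space of flags\<close>

definition seq_space :: "('a::field, int \<Rightarrow> 'a) module"
  where "seq_space =
    \<lparr>carrier = {x. \<exists>N. \<forall>k>N. x k = 0}, mult = undefined, one = undefined,
     zero = (\<lambda>k. 0), add = (\<lambda>x y k. x k + y k),
     smult = (\<lambda>c x k. c * x k)\<rparr>"

definition std_flag :: "int \<Rightarrow> (int \<Rightarrow> 'a::field) set"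
  where "std_flag j = {x \<in> carrier seq_space. \<forall>k>j. x k = 0}"

text \<open>The ambient space is \<open>E N\<close>, so the cosets below are exactly the elements of \<open>E N / E M\<close>.\<close>

definition flag_quotient :: "int \<Rightarrow> int \<Rightarrow> ('a::field, (int \<Rightarrow> 'a) set) module"
  where "flag_quotient M N = quotient_space (seq_space\<lparr>carrier := std_flag N\<rparr>) (std_flag M)"

definition flag_projection :: "int \<Rightarrow> int \<Rightarrow> (int \<Rightarrow> 'a::field) \<Rightarrow> (int \<Rightarrow> 'a) set"
  where "flag_projection M N x = std_flag M +>\<^bsub>seq_space\<lparr>carrier := std_flag N\<rparr>\<^esub> x"

definition complete_flag :: "'a ring \<Rightarrow> ('a, 'b) module \<Rightarrow> nat \<Rightarrow> (nat \<Rightarrow> 'b set) \<Rightarrow> bool"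
  where "complete_flag K V n F \<longleftrightarrow>
    F 0 = {\<zero>\<^bsub>V\<^esub>} \<and> F n = carrier V \<and>
    (\<forall>\<alpha><n. F \<alpha> \<subseteq> F (Suc \<alpha>)) \<and>
    (\<forall>\<alpha>\<le>n. subspace K (F \<alpha>) V \<and> vectorspace.dim K (V\<lparr>carrier := F \<alpha>\<rparr>) = \<alpha>)"

definition Fl_2inf :: "(int \<Rightarrow> (int \<Rightarrow> 'a::field) set) set"
  where "Fl_2inf =
    {V. (\<forall>j. subspace class_ring (V j) seq_space) \<and>
        (\<exists>M N. M \<le> N \<and>
          (\<forall>j\<le>M. V j = std_flag j) \<and> (\<forall>j\<ge>N. V j = std_flag j) \<and>
          (\<exists>F. complete_flag class_ring (flag_quotient M N) (nat (N - M)) F \<and>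
            (\<forall>\<alpha>\<le>nat (N - M). V (M + int \<alpha>) =
               {x \<in> std_flag N. flag_projection M N x \<in> F \<alpha>})))}"

lemma seq_space_vectorspace: "vectorspace class_ring (seq_space :: ('a::field, int \<Rightarrow> 'a) module)"
proof -
  let ?L = "seq_space :: ('a, int \<Rightarrow> 'a) module"
  have "\<exists>N. \<forall>k>N. x k + y k = 0"
    if "\<forall>k>N. x k = 0" "\<forall>k>N'. y k = 0" for x y :: "int \<Rightarrow> 'a" and N N'
    using that by (intro exI[of _ "max N N'"]) auto
  moreover have "\<exists>y. (\<exists>N. \<forall>k>N. y k = 0) \<and> (\<lambda>k. y k + x k) = (\<lambda>k. 0)"
    if "\<forall>k>N. x k = 0" for x :: "int \<Rightarrow> 'a" and N
    using that by (intro exI[of _ "\<lambda>k. - x k"]) auto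
  ultimately have grp: "abelian_group ?L"
    by (intro abelian_groupI) (auto simp: seq_space_def add.assoc add.commute)
  have "\<exists>N. \<forall>k>N. c * x k = 0" if "\<forall>k>N. x k = 0" for c :: 'a and x N
    using that by (intro exI[of _ N]) auto
  then have smult: "c \<odot>\<^bsub>?L\<^esub> x \<in> carrier ?L" if "x \<in> carrier ?L" for c x
    using that by (auto simp: seq_space_def)
  have "module class_ring ?L"
    by (intro Module.module.intro module_axioms.intro class_cring.is_cring grp)
       (simp_all only: smult, simp_all add: seq_space_def algebra_simps)
  then show ?thesis
    unfolding vectorspace_def using class_field.field_axioms by auto
qed

lemma std_flag_subspace: "subspace class_ring (std_flag j) seq_space"
  using seq_space_vectorspace
  by (auto simp: subspace_def submodule_def std_flag_def seq_space_def vectorspace_def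
           intro: exI[of _ j])

lemma flag_quotient_vectorspace:
  assumes "M \<le> N"
  shows "vectorspace class_ring (flag_quotient M N :: ('a::field, (int \<Rightarrow> 'a) set) module)"
proof -
  let ?E = "seq_space\<lparr>carrier := std_flag N\<rparr> :: ('a, int \<Rightarrow> 'a) module"
  have E: "vectorspace class_ring ?E"
    by (rule vectorspace.subspace_is_vs[OF seq_space_vectorspace std_flag_subspace])
  have "subspace class_ring (std_flag M) ?E"
    using E std_flag_subspace[of M, where 'a = 'a] assms
    by (auto simp: subspace_def submodule_def vectorspace_def std_flag_def)
  then show ?thesis
    unfolding flag_quotient_def by (rule quotient_space_vectorspace[OF E])
qed


section \<open>The kernel\<close>

text \<open>
  For \<open>V\<close> and \<open>W\<close> in \<^const>\<open>Fl_2inf\<close> the set counted here is finite, so the convention that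
  \<^const>\<open>card\<close> is 0 on infinite sets is never used.
\<close>

definition flag_k :: "(int \<Rightarrow> 'b set) \<Rightarrow> (int \<Rightarrow> 'b set) \<Rightarrow> nat"
  where "flag_k V W = card {(i, j). V (i + 1) \<inter> W (j + 1) = V i \<inter> W j}"

definition flag_kernel ::
    "(int \<Rightarrow> (int \<Rightarrow> 'a::{finite, field}) set) \<Rightarrow> (int \<Rightarrow> (int \<Rightarrow> 'a) set) \<Rightarrow> real"
  where "flag_kernel V W = (- real CARD('a)) powi (- int (flag_k V W))"

text \<open>
  Positive definiteness is the nonnegativity of the determinants of all finite matrices
  \<open>K (v i) (v j)\<close>; the points may repeat. For a symmetric real kernel this is equivalent to all
  these matrices being positive semidefinite.
\<close>

definition positive_definite_kernel :: "'b set \<Rightarrow> ('b \<Rightarrow> 'b \<Rightarrow> real) \<Rightarrow> bool"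
  where "positive_definite_kernel X K \<longleftrightarrow>
    (\<forall>n (v :: nat \<Rightarrow> 'b). (\<forall>i<n. v i \<in> X) \<longrightarrow> det (mat n n (\<lambda>(i, j). K (v i) (v j))) \<ge> 0)"

end

(*
  Write q for the cardinality of the field. Flags that agree with the standard flag outside a window
  [M, N] form a finite set X, and k(V, W) is the number of inversions of the permutation pos V W that
  gives the relative position of V and W. Call a function on X Steinberg if its sum over every panel
  (the q + 1 flags that differ from a given one in a single term) vanishes. On a panel, pos V takes
  one value for a single flag and, for the q others, that value composed with a simple transposition
  that adds one inversion; so K(V, .) is Steinberg because x + q * (-x/q) = 0. Conversely, the same
  description of panels shows, by induction on the number of inversions, that the sum of a Steinberg
  function f over all W with given pos V W is a multiple of f(V). Hence K * K = c K on X with c > 0,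
  so K is a Gram matrix up to a positive factor.
*)

theory Submission
  imports Defs "HOL-Library.Function_Algebras" "HOL-Combinatorics.Transposition"
    "Jordan_Normal_Form.Char_Poly"
begin

section \<open>Covering pairs of subspaces\<close>

locale finite_field_space = vector_space scale
  for scale :: "'a::{finite, field} \<Rightarrow> 'b::ab_group_add \<Rightarrow> 'b" (infixr "*s" 75)
begin

text \<open>This encodes that \<open>Q / P\<close> is one-dimensional. It asks for a generator
  instead of using a dimension, since the terms of a flag may be infinite-dimensional.\<close>

definition covers :: "'b set \<Rightarrow> 'b set \<Rightarrow> bool"
  where "covers P Q \<longleftrightarrow> subspace P \<and> subspace Q \<and> P \<subseteq> Q \<and>
    (\<exists>x\<in>Q. x \<notin> P \<and> (\<forall>y\<in>Q. \<exists>c. y - c *s x \<in> P))"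

text \<open>For a subspace \<open>P\<close> this is the sum of \<open>P\<close> and the line through
  \<open>x\<close>, phrased so that membership unfolds to the condition in
  \<open>covers\<close>.\<close>

definition adjoin :: "'b set \<Rightarrow> 'b \<Rightarrow> 'b set"
  where "adjoin P x = {y. \<exists>c. y - c *s x \<in> P}"

lemma coversD:
  assumes "covers P Q"
  shows "subspace P" "subspace Q" "P \<subseteq> Q" "\<exists>x\<in>Q. x \<notin> P"
  using assms by (auto simp: covers_def)

text \<open>The coefficient of \<open>z\<close> along the given generator is nonzero because
  \<open>z\<close> lies outside \<open>P\<close>, so that generator can be eliminated: every vector
  of \<open>Q\<close> outside \<open>P\<close> generates \<open>Q\<close> over
  \<open>P\<close>.\<close>

lemma covers_exchange:
  assumes "covers P Q" "z \<in> Q" "z \<notin> P" "u \<in> Q"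
  shows "\<exists>c. u - c *s z \<in> P"
proof -
  obtain x where x: "\<forall>y\<in>Q. \<exists>c. y - c *s x \<in> P"
    using assms(1) by (auto simp: covers_def)
  have P: "subspace P" using assms(1) by (rule coversD)
  obtain a b where a: "z - a *s x \<in> P" and b: "u - b *s x \<in> P" using x assms(2,4) by blast
  have "a \<noteq> 0" using a assms(3) by auto
  have "(u - b *s x) - (b / a) *s (z - a *s x) \<in> P"
    using a b P by (simp add: subspace_diff subspace_scale)
  moreover have "(u - b *s x) - (b / a) *s (z - a *s x) = u - (b / a) *s z"
    using \<open>a \<noteq> 0\<close> by (simp add: scale_right_diff_distrib)
  ultimately show ?thesis by metis
qed

lemma subspace_adjoin: "subspace P \<Longrightarrow> subspace (adjoin P x)"
proof -
  assume P: "subspace P"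
  have "\<exists>d. u + v - d *s x \<in> P" if "u - a *s x \<in> P" "v - b *s x \<in> P" for u v a b
    using subspace_add[OF P that] by (intro exI[of _ "a + b"]) (simp add: algebra_simps)
  moreover have "\<exists>d. c *s u - d *s x \<in> P" if "u - a *s x \<in> P" for u a c
    using subspace_scale[OF P that, of c] by (intro exI[of _ "c * a"]) (simp add: algebra_simps)
  moreover have "\<exists>d. 0 - d *s x \<in> P" using subspace_0[OF P] by (intro exI[of _ 0]) simp
  ultimately show ?thesis by (auto simp: adjoin_def subspace_def)
qed

lemma adjoin_self: "subspace P \<Longrightarrow> x \<in> adjoin P x"
  by (auto simp: adjoin_def subspace_0 intro!: exI[of _ 1])

lemma subset_adjoin: "P \<subseteq> adjoin P x"
  by (auto simp: adjoin_def intro!: exI[of _ 0])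

lemma covers_adjoin:
  assumes "subspace P" "x \<notin> P"
  shows "covers P (adjoin P x)"
  unfolding covers_def
proof (intro conjI bexI[of _ x])
  show "\<forall>y\<in>adjoin P x. \<exists>c. y - c *s x \<in> P" by (simp add: adjoin_def)
qed (use assms subspace_adjoin adjoin_self subset_adjoin in auto)

lemma adjoin_subset:
  assumes "subspace Q" "P \<subseteq> Q" "x \<in> Q"
  shows "adjoin P x \<subseteq> Q"
proof
  fix y assume "y \<in> adjoin P x"
  then obtain c where "y - c *s x \<in> Q" using assms(2) by (auto simp: adjoin_def)
  from subspace_add[OF assms(1) this subspace_scale[OF assms(1,3), of c]] show "y \<in> Q" by simp
qed

lemma covers_eq_adjoin:
  assumes "covers P Q" "x \<in> Q" "x \<notin> P"
  shows "Q = adjoin P x"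
  using covers_exchange[OF assms] adjoin_subset[OF coversD(2,3)[OF assms(1)] assms(2)]
  by (auto simp: adjoin_def)

lemma covers_eq:
  assumes "covers P R" "covers P R'" "x \<in> R" "x \<in> R'" "x \<notin> P"
  shows "R = R'"
  using assms covers_eq_adjoin by metis

text \<open>The quotient \<open>Q / P\<close> is two-dimensional, so dividing it by the line of
  \<open>x\<close> leaves a line. If \<open>x\<close> is in \<open>R\<close>, that line is
  \<open>R / P\<close>; otherwise a vector of \<open>R\<close> outside \<open>P\<close> generates
  \<open>Q\<close> over \<open>adjoin P x\<close>.\<close>

lemma adjoin_covers:
  assumes PR: "covers P R" and RQ: "covers R Q" and x: "x \<in> Q" "x \<notin> P"
  shows "covers (adjoin P x) Q"
proof (cases "x \<in> R")
  case True
  then show ?thesis using covers_eq_adjoin[OF PR True x(2)] RQ by simp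
next
  case False
  note P = coversD(1)[OF PR] and R = coversD(2)[OF PR] and Q = coversD(2)[OF RQ]
  obtain r where r: "r \<in> R" "r \<notin> P" using PR by (auto simp: covers_def)
  have rQ: "r \<in> Q" using r coversD(3)[OF RQ] by auto
  have sub: "adjoin P x \<subseteq> Q"
    using adjoin_subset[OF Q _ x(1)] coversD(3)[OF PR] coversD(3)[OF RQ] by blast
  \<comment> \<open>A congruence of \<open>r\<close> with a multiple of \<open>x\<close> modulo
    \<open>P\<close> would need a nonzero coefficient and so force \<open>x\<close> into
    \<open>R\<close>.\<close>
  have "r \<notin> adjoin P x"
  proof
    assume "r \<in> adjoin P x"
    then obtain c where c: "r - c *s x \<in> P" by (auto simp: adjoin_def)
    then have "c \<noteq> 0" using r by auto
    have "r - c *s x \<in> R" using c coversD(3)[OF PR] by auto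
    then have "r - (r - c *s x) \<in> R" using r(1) R subspace_diff by blast
    then have "(1 / c) *s (c *s x) \<in> R" using subspace_scale[OF R, of "c *s x" "1 / c"] by simp
    then show False using \<open>c \<noteq> 0\<close> False by simp
  qed
  moreover have "\<exists>d. y - d *s r \<in> adjoin P x" if y: "y \<in> Q" for y
  proof -
    obtain c where c: "y - c *s x \<in> R" using covers_exchange[OF RQ x(1) False y] by auto
    obtain d where "y - c *s x - d *s r \<in> P" using covers_exchange[OF PR r c] by auto
    then have "(y - d *s r) - c *s x \<in> P" by (simp add: algebra_simps)
    then show ?thesis by (auto simp: adjoin_def)
  qed
  ultimately show ?thesis
    unfolding covers_def using subspace_adjoin[OF P] Q sub rQ by blast
qed

section \<open>Two-step intervals as projective lines over the finite field\<close>

definition lines_between :: "'b set \<Rightarrow> 'b set \<Rightarrow> 'b set set"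
  where "lines_between P Q = {R. covers P R \<and> covers R Q}"

text \<open>A common vector outside \<open>P\<close> would generate both lines over
  \<open>P\<close>.\<close>

lemma lines_between_Int:
  assumes "R \<in> lines_between P Q" "R' \<in> lines_between P Q" "R \<noteq> R'"
  shows "R \<inter> R' = P"
  using assms covers_eq[of P R R'] coversD(3) by (fastforce simp: lines_between_def)

lemma lines_between_not_subset:
  assumes "R \<in> lines_between P Q" "R' \<in> lines_between P Q" "R \<noteq> R'"
  shows "\<exists>r\<in>R. r \<notin> R'"
  using lines_between_Int[OF assms] assms coversD(4)[of P R] by (auto simp: lines_between_def)

lemma lines_between_sum:
  assumes "R \<in> lines_between P Q" "R' \<in> lines_between P Q" "R \<noteq> R'" "x \<in> Q"
  shows "\<exists>r\<in>R. x - r \<in> R'"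
proof -
  obtain r where r: "r \<in> R" "r \<notin> R'" using lines_between_not_subset[OF assms(1-3)] by auto
  have "r \<in> Q" "covers R' Q" "subspace R"
    using r(1) assms coversD(2)[of P R] coversD(3)[of R Q] by (auto simp: lines_between_def)
  from covers_exchange[OF this(2,1) r(2) assms(4)] obtain c where "x - c *s r \<in> R'" by auto
  then show ?thesis using subspace_scale[OF \<open>subspace R\<close> r(1)] by blast
qed

text \<open>Removing the point \<open>L\<close> from the projective line leaves an affine line: with
  \<open>u\<close> spanning \<open>L\<close> over \<open>P\<close> and \<open>v\<close> outside
  \<open>L\<close>, the other members are generated by the vectors \<open>v + c *s u\<close>, one
  for each scalar \<open>c\<close>.\<close>

lemma card_lines_between:
  assumes L: "L \<in> lines_between P Q"
  shows "card (lines_between P Q - {L}) = CARD('a)" "finite (lines_between P Q)"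
proof -
  have PL: "covers P L" and LQ: "covers L Q" using L by (auto simp: lines_between_def)
  note P = coversD(1)[OF PL] and sL = coversD(2)[OF PL]
  obtain u where u: "u \<in> L" "u \<notin> P" using coversD(4)[OF PL] by auto
  obtain v where v: "v \<in> Q" "v \<notin> L" using coversD(4)[OF LQ] by auto
  have Luv: "v + c *s u \<notin> L" for c
  proof
    assume "v + c *s u \<in> L"
    then have "v + c *s u - c *s u \<in> L" using subspace_diff[OF sL] subspace_scale[OF sL u(1)] by blast
    then show False using v by simp
  qed
  have PQ: "P \<subseteq> L" "L \<subseteq> Q" using coversD PL LQ by auto
  have Quv: "v + c *s u \<in> Q" for c
    using subspace_add[OF coversD(2)[OF LQ] v(1) subspace_scale[OF coversD(2)[OF LQ]]] u PQ by blast
  let ?f = "\<lambda>c. adjoin P (v + c *s u)"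
  have f: "?f c \<in> lines_between P Q - {L}" for c
    using Luv[of c] PQ Quv[of c] covers_adjoin[OF P] adjoin_covers[OF PL LQ] adjoin_self[OF P, of "v + c *s u"]
    by (auto simp: lines_between_def)
  have "inj ?f"
  proof (rule injI, rule ccontr)
    fix c d assume eq: "?f c = ?f d" and ne: "c \<noteq> d"
    \<comment> \<open>The difference of the two generators is a nonzero multiple of
      \<open>u\<close>, so the line would contain \<open>u\<close> and be \<open>L\<close>.\<close>
    have "v + c *s u - (v + d *s u) \<in> ?f c"
      using eq adjoin_self[OF P] subspace_diff[OF subspace_adjoin[OF P]] by metis
    then have "(c - d) *s u \<in> ?f c" by (simp add: algebra_simps)
    then have "(1 / (c - d)) *s (c - d) *s u \<in> ?f c" using subspace_scale[OF subspace_adjoin[OF P]] by blast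
    then have "u \<in> ?f c" using ne by simp
    then have "L = ?f c" using covers_eq[OF PL _ u(1) _ u(2)] f[of c] by (auto simp: lines_between_def)
    then show False using f[of c] by auto
  qed
  moreover have "lines_between P Q - {L} \<subseteq> range ?f"
  proof
    fix R assume R: "R \<in> lines_between P Q - {L}"
    \<comment> \<open>Splitting \<open>v\<close> along \<open>Q = R + L\<close> and reducing its
      \<open>L\<close>-part to a multiple \<open>c *s u\<close> modulo \<open>P\<close> puts
      \<open>v - c *s u\<close> in \<open>R\<close>; hence the parameter \<open>- c\<close>.\<close>
    obtain r where r: "r \<in> R" "v - r \<in> L" using lines_between_sum[of R P Q L v] R L v by auto
    obtain c where c: "v - r - c *s u \<in> P" using covers_exchange[OF PL u r(2)] by auto
    have "covers P R" using R by (auto simp: lines_between_def)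
    have PR: "P \<subseteq> R" and sR: "subspace R" using coversD \<open>covers P R\<close> by auto
    have "(v - r - c *s u) + r \<in> R" using subspace_add[OF sR] c r PR by blast
    then have "v + (- c) *s u \<in> R" by (simp add: algebra_simps)
    then have "R = ?f (- c)" using covers_eq_adjoin[OF \<open>covers P R\<close>] Luv PQ by blast
    then show "R \<in> range ?f" by blast
  qed
  ultimately have "bij_betw ?f UNIV (lines_between P Q - {L})"
    using f by (auto simp: bij_betw_def)
  then have "card (lines_between P Q - {L}) = CARD('a) \<and> finite (lines_between P Q - {L})"
    using bij_betw_same_card bij_betw_finite by fastforce
  then show "card (lines_between P Q - {L}) = CARD('a)" "finite (lines_between P Q)" by auto
qed

end

section \<open>Jumps and inversions\<close>

text \<open>Meaningful only for increasing \<open>V\<close> such that some but not all \<open>V c \<inter> A\<close> lie in \<open>B\<close>.\<close>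

definition jump :: "(int \<Rightarrow> 'c set) \<Rightarrow> 'c set \<Rightarrow> 'c set \<Rightarrow> int"
  where "jump V A B = (THE i. \<forall>c. i \<le> c \<longleftrightarrow> \<not> V c \<inter> A \<subseteq> B)"

lemma jump_eqI:
  assumes "mono V" "\<not> V i \<inter> A \<subseteq> B" "V (i - 1) \<inter> A \<subseteq> B"
  shows "jump V A B = i"
proof -
  have "i \<le> c \<longleftrightarrow> \<not> V c \<inter> A \<subseteq> B" for c
  proof
    assume "i \<le> c"
    then have "V i \<subseteq> V c" by (rule monoD[OF assms(1)])
    then show "\<not> V c \<inter> A \<subseteq> B" using assms(2) by auto
  next
    assume c: "\<not> V c \<inter> A \<subseteq> B"
    show "i \<le> c"
    proof (rule ccontr)
      assume "\<not> i \<le> c"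
      then have "V c \<subseteq> V (i - 1)" by (intro monoD[OF assms(1)]) simp
      then show False using c assms(3) by auto
    qed
  qed
  then show ?thesis unfolding jump_def
    by (intro the_equality) (blast, metis order.antisym order.refl)
qed

lemma jump_exists:
  assumes "mono V" "V l \<inter> A \<subseteq> B" "\<not> V u \<inter> A \<subseteq> B"
  shows "\<not> V (jump V A B) \<inter> A \<subseteq> B" "V (jump V A B - 1) \<inter> A \<subseteq> B"
proof -
  \<comment> \<open>The first failing index is sought among the natural offsets from
    \<open>l\<close>, where a least one exists. It is nonzero because the inclusion holds at
    \<open>l\<close>.\<close>
  define m where "m = (LEAST m. \<not> V (l + int m) \<inter> A \<subseteq> B)"
  have "l < u"
  proof (rule ccontr)
    assume "\<not> l < u"
    then have "V u \<subseteq> V l" by (intro monoD[OF assms(1)]) simp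
    then show False using assms by auto
  qed
  then have "\<not> V (l + int (nat (u - l))) \<inter> A \<subseteq> B" using assms(3) by simp
  then have m: "\<not> V (l + int m) \<inter> A \<subseteq> B" unfolding m_def by (rule LeastI)
  then have "m \<noteq> 0" using assms(2) by (intro notI) simp
  then have m': "V (l + int m - 1) \<inter> A \<subseteq> B"
    using not_less_Least[of "m - 1" "\<lambda>m. \<not> V (l + int m) \<inter> A \<subseteq> B"]
    by (simp add: m_def[symmetric] of_nat_diff algebra_simps)
  show "\<not> V (jump V A B) \<inter> A \<subseteq> B" "V (jump V A B - 1) \<inter> A \<subseteq> B"
    unfolding jump_eqI[OF assms(1) m m'] using m m' by auto
qed

lemma jump_le_iff:
  assumes "mono V" "V l \<inter> A \<subseteq> B" "\<not> V u \<inter> A \<subseteq> B"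
  shows "jump V A B \<le> c \<longleftrightarrow> \<not> V c \<inter> A \<subseteq> B"
proof
  assume "jump V A B \<le> c"
  then have "V (jump V A B) \<subseteq> V c" by (rule monoD[OF assms(1)])
  then show "\<not> V c \<inter> A \<subseteq> B" using jump_exists(1)[OF assms] by auto
next
  assume c: "\<not> V c \<inter> A \<subseteq> B"
  show "jump V A B \<le> c"
  proof (rule ccontr)
    assume "\<not> jump V A B \<le> c"
    then have "V c \<subseteq> V (jump V A B - 1)" by (intro monoD[OF assms(1)]) simp
    then show False using c jump_exists(2)[OF assms] by auto
  qed
qed

section \<open>Inversions and adjacent transpositions\<close>

definition inversions :: "(int \<Rightarrow> int) \<Rightarrow> (int \<times> int) set"
  where "inversions \<tau> = {(y, z). y < z \<and> \<tau> z < \<tau> y}"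

text \<open>An adjacent transposition reverses the order of the pair \<open>(i, i + 1)\<close> only,
  and the assumption makes this pair a new inversion.\<close>

lemma inversions_swap:
  assumes "\<tau> i < \<tau> (i + 1)"
  shows "inversions (\<tau> \<circ> transpose i (i + 1)) =
    insert (i, i + 1) (map_prod (transpose i (i + 1)) (transpose i (i + 1)) ` inversions \<tau>)"
    (is "?L = insert _ (?s ` _)")
proof -
  have less: "transpose i (i + 1) y < transpose i (i + 1) z" if "y < z" "(y, z) \<noteq> (i, i + 1)" for y z :: int
    using that by (auto simp: transpose_def)
  show ?thesis
  proof (intro equalityI subsetI)
    fix p assume p: "p \<in> ?L"
    obtain y z where yz: "p = (y, z)" by (cases p)
    have "?s p \<in> inversions \<tau>" if "p \<noteq> (i, i + 1)"
      using p that less[of y z] by (auto simp: inversions_def yz)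
    moreover have "p = ?s (?s p)" by (simp add: yz)
    ultimately show "p \<in> insert (i, i + 1) (?s ` inversions \<tau>)" by blast
  next
    fix p assume p: "p \<in> insert (i, i + 1) (?s ` inversions \<tau>)"
    show "p \<in> ?L"
    proof (cases "p = (i, i + 1)")
      case True then show ?thesis using assms by (simp add: inversions_def)
    next
      case False
      then obtain y z where yz: "(y, z) \<in> inversions \<tau>" "p = ?s (y, z)" using p by auto
      then have "(y, z) \<noteq> (i, i + 1)" using assms by (auto simp: inversions_def)
      then show ?thesis using yz less[of y z] by (auto simp: inversions_def)
    qed
  qed
qed

lemma card_inversions_swap:
  assumes "\<tau> i < \<tau> (i + 1)" "finite (inversions \<tau>)"
  shows "card (inversions (\<tau> \<circ> transpose i (i + 1))) = Suc (card (inversions \<tau>))"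
proof -
  let ?t = "transpose i (i + 1)"
  have "inj (map_prod ?t ?t)" by (intro prod.inj_map) auto
  \<comment> \<open>The only preimage of this pair is \<open>(i + 1, i)\<close>, which is not
    increasing.\<close>
  moreover have "(i, i + 1) \<notin> map_prod ?t ?t ` inversions \<tau>"
  proof
    assume "(i, i + 1) \<in> map_prod ?t ?t ` inversions \<tau>"
    then obtain y z where "y < z" "?t y = i" "?t z = i + 1" by (auto simp: inversions_def)
    then show False by (auto simp: transpose_def split: if_splits)
  qed
  ultimately show ?thesis
    using assms by (simp add: inversions_swap card_image inj_on_subset)
qed

section \<open>Chains of subspaces meeting a two-step interval\<close>

context finite_field_space
begin

definition chain :: "(int \<Rightarrow> 'b set) \<Rightarrow> bool"
  where "chain V \<longleftrightarrow> (\<forall>j. covers (V j) (V (j + 1)))"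

lemma chain_covers: "chain V \<Longrightarrow> covers (V (j - 1)) (V j)"
  by (metis chain_def diff_add_cancel)

lemma chain_mono: "chain V \<Longrightarrow> mono V"
proof (rule monoI)
  fix i j :: int assume V: "chain V" and "i \<le> j"
  have "V k \<subseteq> V (k + 1)" for k using V coversD(3) by (auto simp: chain_def)
  with \<open>i \<le> j\<close> show "V i \<subseteq> V j"
    by (induction rule: int_ge_induct) blast+
qed

lemma chain_subspace: "chain V \<Longrightarrow> subspace (V j)"
  using coversD(1) by (auto simp: chain_def)

text \<open>The special line is the one through \<open>V a \<inter> Q\<close>, where \<open>a\<close> is the first index for which
  this is not contained in \<open>P\<close>.\<close>

lemma jump_lines_between:
  assumes V: "chain V" and R0: "R0 \<in> lines_between P Q"
    and l: "V l \<inter> Q \<subseteq> P" and u: "Q \<subseteq> V u"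
  obtains L a b where "L \<in> lines_between P Q" "a < b" "jump V L P = a" "jump V Q L = b"
    "\<And>R. R \<in> lines_between P Q \<Longrightarrow> R \<noteq> L \<Longrightarrow> jump V R P = b \<and> jump V Q R = a"
proof -
  note mV = chain_mono[OF V]
  have PR0: "covers P R0" and R0Q: "covers R0 Q" using R0 by (auto simp: lines_between_def)
  obtain q where "q \<in> Q" "q \<notin> R0" using coversD(4)[OF R0Q] by auto
  then have u': "\<not> V u \<inter> Q \<subseteq> P" using coversD(3)[OF PR0] u by auto
  define a where "a = jump V Q P"
  have a: "\<not> V a \<inter> Q \<subseteq> P" "V (a - 1) \<inter> Q \<subseteq> P"
    using jump_exists[OF mV l u'] by (simp_all add: a_def)
  obtain x where x: "x \<in> V a" "x \<in> Q" "x \<notin> P" using a by auto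
  define L where "L = adjoin P x"
  have PL: "covers P L" and LQ: "covers L Q"
    unfolding L_def using covers_adjoin[OF coversD(1)[OF PR0] x(3)] adjoin_covers[OF PR0 R0Q x(2,3)] by auto
  have L: "L \<in> lines_between P Q" using PL LQ by (simp add: lines_between_def)
  have xL: "x \<in> L" unfolding L_def by (rule adjoin_self[OF coversD(1)[OF PR0]])
  have sQ: "subspace Q" by (rule coversD(2)[OF R0Q])
  \<comment> \<open>The vector \<open>x\<close> generates \<open>V a\<close> over
    \<open>V (a - 1)\<close>, so subtracting a multiple of it moves any \<open>y\<close> into
    \<open>V (a - 1) \<inter> Q\<close>, which lies in \<open>P\<close>.\<close>
  have VaL: "V a \<inter> Q \<subseteq> L"
  proof
    fix y assume y: "y \<in> V a \<inter> Q"
    have "x \<notin> V (a - 1)" using a(2) x by auto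
    then obtain c where "y - c *s x \<in> V (a - 1)"
      using covers_exchange[OF chain_covers[OF V] x(1)] y by auto
    moreover have "y - c *s x \<in> Q" using y x sQ subspace_diff subspace_scale by blast
    ultimately have "y - c *s x \<in> P" using a(2) by auto
    then show "y \<in> L" by (auto simp: L_def adjoin_def)
  qed
  obtain w where "w \<in> Q" "w \<notin> L" using coversD(4)[OF LQ] by auto
  then have uL: "\<not> V u \<inter> Q \<subseteq> L" using u by auto
  define b where "b = jump V Q L"
  have b: "\<not> V b \<inter> Q \<subseteq> L" "V (b - 1) \<inter> Q \<subseteq> L"
    using jump_exists[OF mV VaL uL] by (simp_all add: b_def)
  have "a < b"
    using jump_le_iff[OF mV VaL uL, of a] VaL by (auto simp: b_def)
  have "jump V L P = a"
    using a x xL coversD(3)[OF LQ] by (intro jump_eqI[OF mV]) auto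
  moreover have "jump V R P = b \<and> jump V Q R = a" if R: "R \<in> lines_between P Q" "R \<noteq> L" for R
  proof
    have PR: "covers P R" and RQ: "covers R Q" using R by (auto simp: lines_between_def)
    have RL: "R \<inter> L = P" using lines_between_Int[OF R(1) L R(2)] .
    have "V (b - 1) \<inter> R \<subseteq> P" using b(2) RL coversD(3)[OF RQ] by auto
    \<comment> \<open>A vector of \<open>V b \<inter> Q\<close> outside \<open>L\<close> is shifted
      along \<open>x\<close> into \<open>R\<close>. It stays in \<open>V b\<close> because
      \<open>a < b\<close>, and outside \<open>L\<close> because \<open>x\<close> is in
      \<open>L\<close>.\<close>
    moreover have "\<not> V b \<inter> R \<subseteq> P"
    proof -
      obtain z where z: "z \<in> V b" "z \<in> Q" "z \<notin> L" using b by auto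
      obtain r where r: "r \<in> R" "z - r \<in> L" using lines_between_sum[OF R(1) L R(2) z(2)] by auto
      obtain c where c: "z - r - c *s x \<in> P" using covers_exchange[OF PL xL x(3) r(2)] by auto
      have "(z - r - c *s x) + r \<in> R"
        using subspace_add[OF coversD(2)[OF PR]] c r(1) coversD(3)[OF PR] by blast
      then have zR: "z - c *s x \<in> R" by simp
      have "V a \<subseteq> V b" using monoD[OF mV] \<open>a < b\<close> by auto
      then have zV: "z - c *s x \<in> V b"
        using z(1) x(1) chain_subspace[OF V] subspace_diff subspace_scale by blast
      have "z - c *s x \<notin> L"
      proof
        assume "z - c *s x \<in> L"
        then have "(z - c *s x) + c *s x \<in> L"
          using subspace_add[OF coversD(2)[OF PL]] subspace_scale[OF coversD(2)[OF PL] xL] by blast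
        then show False using z(3) by simp
      qed
      then show ?thesis using zR zV coversD(3)[OF PL] by auto
    qed
    ultimately show "jump V R P = b" by (intro jump_eqI[OF mV])
    \<comment> \<open>As \<open>R\<close> meets \<open>L\<close> only in \<open>P\<close>, the
      vector \<open>x\<close> shows that \<open>V a \<inter> Q\<close> already leaves
      \<open>R\<close>.\<close>
    have "x \<notin> R" using RL xL x(3) by auto
    then show "jump V Q R = a"
      using a(2) x coversD(3)[OF PR] by (intro jump_eqI[OF mV]) auto
  qed
  ultimately show ?thesis using that[OF L \<open>a < b\<close>] b_def by auto
qed

text \<open>For complete flags this is the permutation that gives their relative position.\<close>

definition pos :: "(int \<Rightarrow> 'b set) \<Rightarrow> (int \<Rightarrow> 'b set) \<Rightarrow> int \<Rightarrow> int"
  where "pos V W j = jump V (W j) (W (j - 1))"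

end

section \<open>Flags agreeing with a reference flag outside a window\<close>

text \<open>The assumption says that \<open>E N\<close> has finitely many classes modulo
  \<open>E M\<close>, through representatives instead of a quotient space. It makes the set of flags
  below finite.\<close>

locale flag_window = finite_field_space scale
  for scale :: "'a::{finite, field} \<Rightarrow> 'b::ab_group_add \<Rightarrow> 'b" (infixr "*s" 75) +
  fixes E :: "int \<Rightarrow> 'b set" and M N :: int
  assumes finite_quotient: "\<exists>T. finite T \<and> (\<forall>x\<in>E N. \<exists>t\<in>T. x - t \<in> E M)"
begin

text \<open>For a chain \<open>E\<close> and \<open>M \<le> N\<close> this is the complete flag
  variety of \<open>E N / E M\<close>.\<close>

definition flags :: "(int \<Rightarrow> 'b set) set"
  where "flags = {V. chain V \<and> (\<forall>j. j \<le> M \<or> N \<le> j \<longrightarrow> V j = E j)}"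

lemma flags_chain: "V \<in> flags \<Longrightarrow> chain V"
  by (simp add: flags_def)

lemma flags_mono: "V \<in> flags \<Longrightarrow> i \<le> j \<Longrightarrow> V i \<subseteq> V j"
  using chain_mono flags_chain by (blast dest: monoD)

lemma flags_outside: "V \<in> flags \<Longrightarrow> j \<le> M \<or> N \<le> j \<Longrightarrow> V j = E j"
  by (auto simp: flags_def)

lemma flags_lower:
  assumes "V \<in> flags" "W \<in> flags"
  shows "V (min M a) \<subseteq> W a"
  using flags_outside[OF assms(1), of "min M a"] flags_outside[OF assms(2), of "min M a"]
    flags_mono[OF assms(2), of "min M a" a] by auto

lemma flags_upper:
  assumes "V \<in> flags" "W \<in> flags"
  shows "W b \<subseteq> V (max N b)"
  using flags_outside[OF assms(1), of "max N b"] flags_outside[OF assms(2), of "max N b"]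
    flags_mono[OF assms(2), of b "max N b"] by auto

lemma flags_step:
  assumes "W \<in> flags"
  shows "\<not> W j \<subseteq> W (j - 1)"
  using coversD(4)[OF chain_covers[OF flags_chain[OF assms], of j]] by auto

lemma
  assumes "V \<in> flags" "W \<in> flags"
  shows pos_meets: "\<not> V (pos V W j) \<inter> W j \<subseteq> W (j - 1)"
    and pos_before: "V (pos V W j - 1) \<inter> W j \<subseteq> W (j - 1)"
    and pos_le_iff: "pos V W j \<le> c \<longleftrightarrow> \<not> V c \<inter> W j \<subseteq> W (j - 1)"
proof -
  \<comment> \<open>Beyond the window both flags agree with \<open>E\<close>, which gives one index
    before the jump and one after it.\<close>
  have l: "V (min M (j - 1)) \<inter> W j \<subseteq> W (j - 1)" using flags_lower[OF assms] by auto
  have u: "\<not> V (max N j) \<inter> W j \<subseteq> W (j - 1)"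
    using flags_upper[OF assms, of j] flags_step[OF assms(2), of j] by auto
  note mono = chain_mono[OF flags_chain[OF assms(1)]]
  show "\<not> V (pos V W j) \<inter> W j \<subseteq> W (j - 1)" "V (pos V W j - 1) \<inter> W j \<subseteq> W (j - 1)"
    "pos V W j \<le> c \<longleftrightarrow> \<not> V c \<inter> W j \<subseteq> W (j - 1)"
    unfolding pos_def using jump_exists[OF mono l u] jump_le_iff[OF mono l u] by auto
qed

text \<open>This makes \<open>pos V W\<close> a permutation with inverse \<open>pos W V\<close>. If
  \<open>V\<close> at \<open>?x\<close> met \<open>W (y - 1)\<close> in some \<open>z\<close>
  outside \<open>V (?x - 1)\<close>, the exchange property would move the vector \<open>u\<close>
  into \<open>V (?x - 1) \<inter> W y\<close> by a multiple of \<open>z\<close>, forcing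
  \<open>u\<close> into \<open>W (y - 1)\<close>.\<close>

lemma pos_pos:
  assumes V: "V \<in> flags" and W: "W \<in> flags"
  shows "pos W V (pos V W y) = y"
proof -
  let ?x = "pos V W y"
  note meets = pos_meets[OF assms, of y] and before = pos_before[OF assms, of y]
  obtain u where u: "u \<in> V ?x" "u \<in> W y" "u \<notin> W (y - 1)" using meets by auto
  have "\<not> W y \<inter> V ?x \<subseteq> V (?x - 1)" using u before by auto
  moreover have "W (y - 1) \<inter> V ?x \<subseteq> V (?x - 1)"
  proof (rule ccontr)
    assume "\<not> W (y - 1) \<inter> V ?x \<subseteq> V (?x - 1)"
    then obtain z where z: "z \<in> W (y - 1)" "z \<in> V ?x" "z \<notin> V (?x - 1)" by auto
    obtain c where c: "u - c *s z \<in> V (?x - 1)"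
      using covers_exchange[OF chain_covers[OF flags_chain[OF V]] z(2,3) u(1)] by auto
    have sW: "subspace (W j)" for j using chain_subspace[OF flags_chain[OF W]] .
    have "z \<in> W y" using z(1) flags_mono[OF W, of "y - 1" y] by auto
    then have "u - c *s z \<in> W y" using u(2) sW subspace_diff subspace_scale by blast
    then have "(u - c *s z) + c *s z \<in> W (y - 1)"
      using c before sW[of "y - 1"] z(1) subspace_add subspace_scale by blast
    then show False using u(3) by simp
  qed
  ultimately show ?thesis
    unfolding pos_def[of W V] by (intro jump_eqI chain_mono flags_chain W)
qed

text \<open>The equality splits into two inclusions, each saying that a jump of one flag against a
  step of the other has not yet occurred.\<close>

lemma inter_step_eq_iff:
  assumes V: "V \<in> flags" and W: "W \<in> flags"
  shows "V (i + 1) \<inter> W (j + 1) = V i \<inter> W j \<longleftrightarrow> i + 1 < pos V W (j + 1) \<and> j + 1 < pos W V (i + 1)"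
proof -
  have "V (i + 1) \<inter> W (j + 1) = V i \<inter> W j \<longleftrightarrow>
    V (i + 1) \<inter> W (j + 1) \<subseteq> W j \<and> W (j + 1) \<inter> V (i + 1) \<subseteq> V i"
    using flags_mono[OF V, of i "i + 1"] flags_mono[OF W, of j "j + 1"] by auto
  also have "\<dots> \<longleftrightarrow> i + 1 < pos V W (j + 1) \<and> j + 1 < pos W V (i + 1)"
    using pos_le_iff[OF V W, of "j + 1" "i + 1"] pos_le_iff[OF W V, of "i + 1" "j + 1"] by (simp add: not_le[symmetric])
  finally show ?thesis .
qed

text \<open>Put \<open>i + 1 = pos V W z\<close> and \<open>j + 1 = y\<close>. Since
  \<open>pos W V\<close> is the inverse permutation, the two inequalities of
  \<open>inter_step_eq_iff\<close> become \<open>pos V W z < pos V W y\<close> and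
  \<open>y < z\<close>.\<close>

lemma flag_k_eq_card_inversions:
  assumes V: "V \<in> flags" and W: "W \<in> flags"
  shows "flag_k V W = card (inversions (pos V W))"
proof -
  have "bij_betw (\<lambda>(y, z). (pos V W z - 1, y - 1)) (inversions (pos V W))
      {(i, j). V (i + 1) \<inter> W (j + 1) = V i \<inter> W j}"
    by (rule bij_betw_byWitness[where f' = "\<lambda>(i, j). (j + 1, pos W V (i + 1))"])
       (auto simp: inter_step_eq_iff[OF assms] inversions_def pos_pos[OF V W] pos_pos[OF W V])
  then show ?thesis unfolding flag_k_def by (simp add: bij_betw_same_card)
qed

lemma flag_k_commute: "flag_k V W = flag_k W V"
  unfolding flag_k_def
  by (rule bij_betw_same_card[of prod.swap])
     (auto intro!: bij_betw_byWitness[where f' = prod.swap])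

lemma pos_outside:
  assumes V: "V \<in> flags" and W: "W \<in> flags" and j: "j \<le> M \<or> N < j"
  shows "pos V W j = j"
proof -
  \<comment> \<open>Strictness in \<open>N < j\<close> keeps \<open>j - 1\<close> at or above
    \<open>N\<close>, so both ends of the step agree.\<close>
  have eq: "V j = W j" "V (j - 1) = W (j - 1)" using j flags_outside[OF V] flags_outside[OF W] by auto
  show ?thesis unfolding pos_def
    using flags_step[OF W, of j] by (intro jump_eqI chain_mono flags_chain V) (auto simp: eq)
qed

lemma pos_le_window:
  assumes V: "V \<in> flags" and W: "W \<in> flags" and j: "j \<le> N"
  shows "pos V W j \<le> N"
proof -
  have "W j \<subseteq> V N"
    using flags_mono[OF W j] flags_outside[OF V, of N] flags_outside[OF W, of N] by auto
  then show ?thesis using flags_step[OF W, of j] by (auto simp: pos_le_iff[OF V W])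
qed

lemma pos_greater_window:
  assumes V: "V \<in> flags" and W: "W \<in> flags" and j: "M < j"
  shows "M < pos V W j"
proof -
  have "V M \<subseteq> W (j - 1)"
    using flags_mono[OF W, of M "j - 1"] j flags_outside[OF V, of M] flags_outside[OF W, of M] by auto
  then show ?thesis using pos_le_iff[OF V W, of j M] by auto
qed

text \<open>The permutation fixes every index outside \<open>{M<..N}\<close> and maps this interval
  to itself, so both entries of an inversion lie in it.\<close>

lemma finite_inversions_pos:
  assumes V: "V \<in> flags" and W: "W \<in> flags"
  shows "finite (inversions (pos V W))"
proof (rule finite_subset)
  show "inversions (pos V W) \<subseteq> {M<..N} \<times> {M<..N}"
  proof clarify
    fix y z assume yz: "(y, z) \<in> inversions (pos V W)"
    have "M < y"
      using yz pos_outside[OF assms, of y] pos_outside[OF assms, of z] pos_greater_window[OF assms, of z]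
      by (cases "z \<le> M"; cases "y \<le> M") (auto simp: inversions_def)
    moreover have "z \<le> N"
      using yz pos_outside[OF assms, of y] pos_outside[OF assms, of z] pos_le_window[OF assms, of y]
      by (cases "z \<le> N"; cases "y \<le> N") (auto simp: inversions_def)
    ultimately show "y \<in> {M<..N} \<and> z \<in> {M<..N}" using yz by (auto simp: inversions_def)
  qed
qed auto

text \<open>Going down from \<open>N\<close>, the ascents force \<open>pos V W j \<le> j\<close>.
  Going up from \<open>M\<close>, this yields a common vector of \<open>V (j + 1)\<close> and
  \<open>W (j + 1)\<close> outside the shared term at \<open>j\<close>, and it generates
  both.\<close>

lemma flags_eqI:
  assumes V: "V \<in> flags" and W: "W \<in> flags"
    and asc: "\<And>i. M < i \<Longrightarrow> i < N \<Longrightarrow> pos V W i < pos V W (i + 1)"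
  shows "W = V"
proof -
  have le: "j \<le> N \<Longrightarrow> M < j \<longrightarrow> pos V W j \<le> j" for j
  proof (induction j rule: int_le_induct)
    case base then show ?case using pos_le_window[OF V W, of N] by simp
  next
    case (step j) then show ?case using asc[of "j - 1"] by auto
  qed
  have "M \<le> j \<Longrightarrow> W j = V j" for j
  proof (induction j rule: int_ge_induct)
    case base then show ?case using flags_outside[OF V, of M] flags_outside[OF W, of M] by simp
  next
    case (step j)
    have "pos V W (j + 1) \<le> j + 1"
      using le[of "j + 1"] step(1) pos_outside[OF V W, of "j + 1"] by (cases "j + 1 \<le> N") auto
    then obtain u where "u \<in> V (j + 1)" "u \<in> W (j + 1)" "u \<notin> W j"
      using pos_le_iff[OF V W, of "j + 1" "j + 1"] by auto
    moreover have "covers (W j) (V (j + 1))" "covers (W j) (W (j + 1))"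
      using flags_chain[OF V] flags_chain[OF W] step unfolding chain_def by metis+
    ultimately show ?case using covers_eq by blast
  qed
  moreover have "W j = V j" if "j \<le> M" for j
    using that flags_outside[OF V, of j] flags_outside[OF W, of j] by simp
  ultimately show ?thesis by (metis ext nle_le)
qed

section \<open>Panels and the relative positions on them\<close>

definition panel :: "int \<Rightarrow> (int \<Rightarrow> 'b set) \<Rightarrow> (int \<Rightarrow> 'b set) set"
  where "panel i W = (\<lambda>R. W(i := R)) ` lines_between (W (i - 1)) (W (i + 1))"

lemma flags_lines_between: "W \<in> flags \<Longrightarrow> W i \<in> lines_between (W (i - 1)) (W (i + 1))"
  using chain_covers[of W] flags_chain[of W] by (auto simp: lines_between_def chain_def)

lemma panel_self: "W \<in> flags \<Longrightarrow> W \<in> panel i W"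
  using flags_lines_between[of W i] by (auto simp: panel_def image_iff intro!: bexI[of _ "W i"])

lemma panel_subset_flags:
  assumes "W \<in> flags" "M < i" "i < N"
  shows "panel i W \<subseteq> flags"
proof
  fix W' assume "W' \<in> panel i W"
  then obtain R where R: "R \<in> lines_between (W (i - 1)) (W (i + 1))" "W' = W(i := R)"
    by (auto simp: panel_def)
  have "covers (W' j) (W' (j + 1))" for j
    using R flags_chain[OF assms(1)]
    by (cases "j = i"; cases "j = i - 1") (auto simp: lines_between_def chain_def)
  then show "W' \<in> flags" using assms R by (auto simp: flags_def chain_def)
qed

text \<open>A panel depends only on the terms away from \<open>i\<close>, so all its members have
  the same panel.\<close>

lemma panel_commute: "W \<in> flags \<Longrightarrow> W' \<in> panel i W \<Longrightarrow> W \<in> panel i W'"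
  using flags_lines_between[of W i] by (auto simp: panel_def image_iff intro!: bexI[of _ "W i"])

lemma card_panel:
  assumes "W \<in> flags"
  shows "finite (panel i W)" "card (panel i W) = Suc CARD('a)"
proof -
  let ?S = "lines_between (W (i - 1)) (W (i + 1))"
  have W: "W i \<in> ?S" using flags_lines_between[OF assms] .
  have fin: "finite ?S" using card_lines_between(2)[OF W] .
  have "inj_on (\<lambda>R. W(i := R)) ?S" by (auto intro!: inj_onI dest: fun_upd_eqD)
  then have "card (panel i W) = card ?S" by (simp add: panel_def card_image)
  also have "\<dots> = Suc CARD('a)" using card_lines_between(1)[OF W] W fin by (metis card.remove)
  finally show "card (panel i W) = Suc CARD('a)" .
  show "finite (panel i W)" using fin by (simp add: panel_def)
qed

text \<open>The flag \<open>U\<close> carries the special line of \<open>jump_lines_between\<close>.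
  On every other line the two jumps are exchanged.\<close>

lemma panel_pos:
  assumes V: "V \<in> flags" and W: "W \<in> flags" and i: "M < i" "i < N"
  obtains U where "U \<in> panel i W" "pos V U i < pos V U (i + 1)"
    "\<And>W'. W' \<in> panel i W \<Longrightarrow> W' \<noteq> U \<Longrightarrow> pos V W' = pos V U \<circ> transpose i (i + 1)"
proof -
  let ?P = "W (i - 1)" and ?Q = "W (i + 1)"
  have "V (min M (i - 1)) \<inter> ?Q \<subseteq> ?P" using flags_lower[OF V W] by auto
  from jump_lines_between[OF flags_chain[OF V] flags_lines_between[OF W] this flags_upper[OF V W]]
  obtain L a b where L: "L \<in> lines_between ?P ?Q" "a < b" "jump V L ?P = a" "jump V ?Q L = b"
    and R: "\<And>R. R \<in> lines_between ?P ?Q \<Longrightarrow> R \<noteq> L \<Longrightarrow> jump V R ?P = b \<and> jump V ?Q R = a"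
    by blast
  define U where "U = W(i := L)"
  have U: "U \<in> panel i W" using L by (auto simp: U_def panel_def)
  have posU: "pos V U i = a" "pos V U (i + 1) = b" using L by (auto simp: pos_def U_def)
  show ?thesis
  proof (rule that[OF U])
    show "pos V U i < pos V U (i + 1)" using posU L by simp
    fix W' assume "W' \<in> panel i W" "W' \<noteq> U"
    then obtain R where "R \<in> lines_between ?P ?Q" "R \<noteq> L" and W': "W' = W(i := R)"
      by (auto simp: panel_def U_def)
    then have "pos V W' i = b" "pos V W' (i + 1) = a" using R[of R] by (auto simp: pos_def)
    \<comment> \<open>The value at \<open>j\<close> involves only the terms at \<open>j\<close> and
      \<open>j - 1\<close>, so changing the term at \<open>i\<close> affects just \<open>i\<close>
      and \<open>i + 1\<close>.\<close>
    moreover have "pos V W' j = pos V U j" if "j \<noteq> i" "j \<noteq> i + 1" for j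
      using that by (auto simp: pos_def W' U_def)
    ultimately show "pos V W' = pos V U \<circ> transpose i (i + 1)"
      using posU by (auto simp: fun_eq_iff transpose_def)
  qed
qed

text \<open>Each term inside the window is a union of cosets of \<open>E M\<close> within
  \<open>E N\<close>, so it is determined by the representatives in \<open>T\<close> that it
  contains.\<close>

lemma finite_flags: "finite flags"
proof -
  obtain T where T: "finite T" "\<And>x. x \<in> E N \<Longrightarrow> \<exists>t\<in>T. x - t \<in> E M"
    using finite_quotient by auto
  define r where "r V = restrict (\<lambda>j. V j \<inter> T) {M<..<N}" for V :: "int \<Rightarrow> 'b set"
  have "inj_on r flags"
  proof (rule inj_onI, rule ext)
    fix V W j assume V: "V \<in> flags" and W: "W \<in> flags" and eq: "r V = r W"
    have sub: "V j \<subseteq> W j" if V: "V \<in> flags" and W: "W \<in> flags" and eq: "r V = r W" and j: "M < j" "j < N" for V W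
    proof
      fix x assume x: "x \<in> V j"
      have "V j \<subseteq> E N" using flags_mono[OF V, of j N] flags_outside[OF V, of N] j by auto
      then obtain t where t: "t \<in> T" "x - t \<in> E M" using T(2) x by blast
      have EV: "E M \<subseteq> V j" "E M \<subseteq> W j"
        using flags_mono[OF V, of M j] flags_mono[OF W, of M j] flags_outside[OF V, of M] flags_outside[OF W, of M] j by auto
      have "x - (x - t) \<in> V j"
        using subspace_diff[OF chain_subspace[OF flags_chain[OF V]] x] t EV by blast
      moreover have "V j \<inter> T = W j \<inter> T" using fun_cong[OF eq, of j] j by (simp add: r_def)
      ultimately have "t \<in> W j" using t by auto
      then have "(x - t) + t \<in> W j"
        using subspace_add[OF chain_subspace[OF flags_chain[OF W]]] t EV by blast
      then show "x \<in> W j" by simp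
    qed
    show "V j = W j"
    proof (cases "M < j \<and> j < N")
      case True then show ?thesis using sub[OF V W eq] sub[OF W V eq[symmetric]] by auto
    next
      case False then show ?thesis using flags_outside[OF V, of j] flags_outside[OF W, of j] by auto
    qed
  qed
  moreover have "r ` flags \<subseteq> PiE {M<..<N} (\<lambda>_. Pow T)" by (auto simp: r_def)
  moreover have "finite (PiE {M<..<N} (\<lambda>_. Pow T))" using T(1) by (intro finite_PiE) auto
  ultimately show ?thesis by (metis finite_imageD finite_subset)
qed

end

section \<open>Determinants of positive semidefinite matrices\<close>

text \<open>The monic characteristic polynomial of \<open>- A\<close> takes the value
  \<open>det A\<close> at 0. Were this negative, the polynomial would have a positive root
  \<open>e\<close>, and an eigenvector of \<open>- A\<close> for \<open>e\<close> would make the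
  quadratic form of \<open>A\<close> negative.\<close>

lemma det_nonneg_of_psd:
  fixes A :: "real mat"
  assumes A: "A \<in> carrier_mat n n"
    and psd: "\<And>x. x \<in> carrier_vec n \<Longrightarrow> 0 \<le> x \<bullet> (A *\<^sub>v x)"
  shows "0 \<le> det A"
proof (rule ccontr)
  assume neg: "\<not> 0 \<le> det A"
  have mA: "- A \<in> carrier_mat n n" using A by simp
  define p where "p = char_poly (- A)"
  have "poly p 0 = det A"
  proof -
    have "poly p 0 = det (- (- A + 0 \<cdot>\<^sub>m 1\<^sub>m n))"
      unfolding p_def using char_poly_matrix[OF mA, of 0] mA A by (simp add: char_matrix_def)
    also have "- (- A + 0 \<cdot>\<^sub>m 1\<^sub>m n) = A" using A by auto
    finally show ?thesis .
  qed
  then have "poly p 0 < 0" using neg by simp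
  have "lead_coeff p > 0" unfolding p_def using degree_monic_char_poly[OF mA] by simp
  then obtain m where m: "\<And>x. x \<ge> m \<Longrightarrow> poly p x \<ge> lead_coeff p"
    using poly_pinfty_gt_lc by blast
  have "poly p (max m 1) > 0" using m[of "max m 1"] \<open>lead_coeff p > 0\<close> by auto
  then obtain e where e: "0 < e" "poly p e = 0"
    using poly_IVT_pos[of 0 "max m 1" p] \<open>poly p 0 < 0\<close> by (auto simp: less_max_iff_disj)
  then have "eigenvalue (- A) e" using eigenvalue_root_char_poly[OF mA] p_def by simp
  then obtain x where x: "x \<in> carrier_vec n" "x \<noteq> 0\<^sub>v n" "(- A) *\<^sub>v x = e \<cdot>\<^sub>v x"
    using A by (auto simp: eigenvalue_def eigenvector_def)
  have "x \<bullet> (A *\<^sub>v x) = - (x \<bullet> ((- A) *\<^sub>v x))" using A x(1) by simp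
  also have "\<dots> = - e * (x \<bullet> x)" using x by simp
  also have "\<dots> < 0"
    using e(1) x(1,2) conjugate_square_greater_0_vec[of x n] by simp
  finally show False using psd[OF x(1)] by simp
qed

text \<open>Up to the factor \<open>c\<close>, the matrix is the Gram matrix of the functions
  \<open>K (v i)\<close> on \<open>X\<close>, so its quadratic form is a sum of squares over
  \<open>X\<close>.\<close>

lemma det_nonneg_of_reproducing_kernel:
  fixes K :: "'c \<Rightarrow> 'c \<Rightarrow> real"
  assumes X: "finite X" and c: "0 < c"
    and sym: "\<And>x y. K x y = K y x"
    and square: "\<And>x y. x \<in> X \<Longrightarrow> y \<in> X \<Longrightarrow> (\<Sum>w\<in>X. K x w * K w y) = c * K x y"
    and v: "\<And>i. i < n \<Longrightarrow> v i \<in> X"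
  shows "0 \<le> det (mat n n (\<lambda>(i, j). K (v i) (v j)))"
proof (rule det_nonneg_of_psd)
  let ?A = "mat n n (\<lambda>(i, j). K (v i) (v j))"
  show "?A \<in> carrier_mat n n" by simp
  fix x :: "real vec" assume x: "x \<in> carrier_vec n"
  have "c * (x \<bullet> (?A *\<^sub>v x)) = (\<Sum>i<n. \<Sum>j<n. x $ i * x $ j * (c * K (v i) (v j)))"
    using x by (simp add: scalar_prod_def lessThan_atLeast0 sum_distrib_left mult_ac)
  also have "\<dots> = (\<Sum>i<n. \<Sum>j<n. \<Sum>w\<in>X. x $ i * x $ j * (K (v i) w * K w (v j)))"
    using v by (intro sum.cong refl) (simp add: square[symmetric] sum_distrib_left)
  also have "\<dots> = (\<Sum>i<n. \<Sum>w\<in>X. \<Sum>j<n. x $ i * x $ j * (K (v i) w * K w (v j)))"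
    by (intro sum.cong refl) (rule sum.swap)
  also have "\<dots> = (\<Sum>w\<in>X. \<Sum>i<n. \<Sum>j<n. x $ i * x $ j * (K (v i) w * K w (v j)))"
    by (rule sum.swap)
  also have "\<dots> = (\<Sum>w\<in>X. (\<Sum>i<n. x $ i * K (v i) w)\<^sup>2)"
    by (simp add: power2_eq_square sum_product sym mult_ac)
  also have "\<dots> \<ge> 0" by (intro sum_nonneg) simp
  finally show "0 \<le> x \<bullet> (?A *\<^sub>v x)" using c by (simp add: zero_le_mult_iff)
qed

section \<open>The kernel as a multiple of a projection\<close>

context flag_window
begin

text \<open>For a chain \<open>E\<close> and \<open>M \<le> N\<close>, the restrictions of these
  functions to \<open>flags\<close> are the top-dimensional cycles of the Tits building of
  \<open>E N / E M\<close>, which form the Steinberg representation.\<close>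

definition steinberg :: "((int \<Rightarrow> 'b set) \<Rightarrow> real) set"
  where "steinberg = {f. \<forall>W\<in>flags. \<forall>i. M < i \<longrightarrow> i < N \<longrightarrow> (\<Sum>W'\<in>panel i W. f W') = 0}"

text \<open>The inverse of \<open>- q\<close> for the field size \<open>q\<close>, so that the
  negative integer power in \<open>flag_kernel\<close> becomes a natural power.\<close>

definition \<kappa> :: real
  where "\<kappa> = - 1 / real CARD('a)"

definition K :: "(int \<Rightarrow> 'b set) \<Rightarrow> (int \<Rightarrow> 'b set) \<Rightarrow> real"
  where "K V W = \<kappa> ^ flag_k V W"

lemma K_commute: "K V W = K W V"
  unfolding K_def by (subst flag_k_commute) simp

lemma K_eq: "V \<in> flags \<Longrightarrow> W \<in> flags \<Longrightarrow> K V W = \<kappa> ^ card (inversions (pos V W))"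
  by (simp add: K_def flag_k_eq_card_inversions)

lemma pos_self: "V \<in> flags \<Longrightarrow> pos V V j = j"
  unfolding pos_def using flags_step by (intro jump_eqI chain_mono flags_chain) auto

lemma K_nonzero: "K V W \<noteq> 0"
  by (simp add: K_def \<kappa>_def)

text \<open>Among the \<open>q + 1\<close> members of a panel, \<open>q\<close> have one inversion
  more than \<open>U\<close>, so the sum is \<open>K V U\<close> times
  \<open>1 + q * \<kappa> = 0\<close>.\<close>

lemma K_steinberg:
  assumes V: "V \<in> flags"
  shows "K V \<in> steinberg"
  unfolding steinberg_def
proof clarify
  fix W i assume W: "W \<in> flags" and i: "M < i" "i < N"
  obtain U where U: "U \<in> panel i W" "pos V U i < pos V U (i + 1)"
    and rest: "\<And>W'. W' \<in> panel i W \<Longrightarrow> W' \<noteq> U \<Longrightarrow> pos V W' = pos V U \<circ> transpose i (i + 1)"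
    using panel_pos[OF V W i] by blast
  have flags: "panel i W \<subseteq> flags" using panel_subset_flags[OF W i] .
  have "K V W' = \<kappa> * K V U" if "W' \<in> panel i W - {U}" for W'
  proof -
    have "W' \<in> flags" "U \<in> flags" using that U flags by auto
    then show ?thesis
      using that rest[of W'] card_inversions_swap[OF U(2) finite_inversions_pos[OF V \<open>U \<in> flags\<close>]]
      by (simp add: K_eq[OF V])
  qed
  then have "(\<Sum>W'\<in>panel i W - {U}. K V W') = real (card (panel i W - {U})) * (\<kappa> * K V U)" by simp
  also have "\<dots> = - K V U" using card_panel[OF W, of i] U(1) by (simp add: \<kappa>_def)
  finally show "(\<Sum>W'\<in>panel i W. K V W') = 0"
    using sum.remove[OF card_panel(1)[OF W] U(1), of "K V"] by simp
qed

text \<open>Double counting: adding up the vanishing panel sums over \<open>C\<close> counts every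
  member of \<open>C\<close> once for each of the \<open>q + 1\<close> flags in its panel.\<close>

lemma steinberg_sum_eq_0:
  assumes f: "f \<in> steinberg" and i: "M < i" "i < N"
    and C: "C \<subseteq> flags" "\<And>W. W \<in> C \<Longrightarrow> panel i W \<subseteq> C"
  shows "(\<Sum>W\<in>C. f W) = 0"
proof -
  have fin: "finite C" using C(1) finite_flags finite_subset by auto
  have "0 = (\<Sum>W\<in>C. \<Sum>W'\<in>panel i W. f W')"
    using f C(1) i by (intro sum.neutral[symmetric]) (auto simp: steinberg_def)
  also have "\<dots> = (\<Sum>W\<in>C. \<Sum>W'\<in>{W' \<in> C. W' \<in> panel i W}. f W')"
    using C(2) by (intro sum.cong refl) auto
  also have "\<dots> = (\<Sum>W'\<in>C. \<Sum>W\<in>{W \<in> C. W' \<in> panel i W}. f W')"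
    by (rule sum.swap_restrict[OF fin fin])
  also have "\<dots> = (\<Sum>W'\<in>C. real (Suc CARD('a)) * f W')"
  proof (intro sum.cong refl)
    fix W' assume W': "W' \<in> C"
    then have "{W \<in> C. W' \<in> panel i W} = panel i W'" using C panel_commute by blast
    then show "(\<Sum>W\<in>{W \<in> C. W' \<in> panel i W}. f W') = real (Suc CARD('a)) * f W'"
      using card_panel(2)[of W' i] W' C(1) by auto
  qed
  also have "\<dots> = real (Suc CARD('a)) * (\<Sum>W'\<in>C. f W')" by (simp add: sum_distrib_left)
  finally show ?thesis by simp
qed

section \<open>Sums of Steinberg functions over Schubert cells\<close>

definition schubert_cell :: "(int \<Rightarrow> 'b set) \<Rightarrow> (int \<Rightarrow> int) \<Rightarrow> (int \<Rightarrow> 'b set) set"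
  where "schubert_cell V \<tau> = {W \<in> flags. pos V W = \<tau>}"

text \<open>The factor \<open>r\<close> does not depend on \<open>f\<close>. At a descent
  \<open>i\<close> of \<tau>, the cells of \<tau> and of \<tau> composed with the transposition
  together form a union of panels, so their sums are opposite, and the second cell has fewer
  inversions.\<close>

lemma steinberg_sum_cell:
  assumes V: "V \<in> flags"
  shows "\<exists>r. \<forall>f\<in>steinberg. (\<Sum>W\<in>schubert_cell V \<tau>. f W) = r * f V"
proof (induction "card (inversions \<tau>)" arbitrary: \<tau> rule: less_induct)
  case less
  show ?case
  proof (cases "schubert_cell V \<tau> = {}")
    case True then show ?thesis by (auto intro: exI[of _ 0])
  next
    case False
    then obtain W where W: "W \<in> flags" and \<tau>: "\<tau> = pos V W" by (auto simp: schubert_cell_def)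
    show ?thesis
    proof (cases "\<forall>i. M < i \<longrightarrow> i < N \<longrightarrow> \<tau> i < \<tau> (i + 1)")
      case True
      \<comment> \<open>Without a descent in the window only \<open>V\<close> itself remains, hence
        the factor 1.\<close>
      then have "schubert_cell V \<tau> \<subseteq> {V}" using flags_eqI[OF V] by (auto simp: schubert_cell_def)
      with False have "schubert_cell V \<tau> = {V}" by auto
      then show ?thesis by (auto intro: exI[of _ 1])
    next
      case False
      then obtain i where i: "M < i" "i < N" and desc: "\<not> \<tau> i < \<tau> (i + 1)" by auto
      define \<tau>' where "\<tau>' = \<tau> \<circ> transpose i (i + 1)"
      have \<tau>\<tau>': "\<tau> = \<tau>' \<circ> transpose i (i + 1)" by (simp add: \<tau>'_def fun_eq_iff)
      obtain U where U: "U \<in> panel i W" "pos V U i < pos V U (i + 1)"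
        and rest: "\<And>W'. W' \<in> panel i W \<Longrightarrow> W' \<noteq> U \<Longrightarrow> pos V W' = pos V U \<circ> transpose i (i + 1)"
        using panel_pos[OF V W i] by blast
      have "U \<in> flags" using U panel_subset_flags[OF W i] by auto
      \<comment> \<open>The special flag \<open>U\<close> has an ascent at \<open>i\<close> while
        \<open>W\<close> has a descent, so \<tau>' is the position of \<open>U\<close>.\<close>
      have "W \<noteq> U" using U desc \<tau> by auto
      then have "\<tau> = pos V U \<circ> transpose i (i + 1)" using rest[OF panel_self[OF W]] \<tau> by simp
      then have \<tau>': "\<tau>' = pos V U" by (simp add: \<tau>'_def fun_eq_iff)
      have asc: "\<tau>' i < \<tau>' (i + 1)" using U by (simp add: \<tau>')
      have "card (inversions \<tau>') < card (inversions \<tau>)"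
        using card_inversions_swap[OF asc] finite_inversions_pos[OF V \<open>U \<in> flags\<close>] \<tau>\<tau>' \<tau>' by simp
      from less[OF this] obtain r where r: "\<forall>f\<in>steinberg. (\<Sum>W\<in>schubert_cell V \<tau>'. f W) = r * f V" by auto
      let ?C = "schubert_cell V \<tau> \<union> schubert_cell V \<tau>'"
      have C: "?C \<subseteq> flags" by (auto simp: schubert_cell_def)
      \<comment> \<open>Only two positions occur on a panel, exchanged by the transposition, and
        this exchange also swaps \<tau> and \<tau>'.\<close>
      have closed: "panel i Z \<subseteq> ?C" if "Z \<in> ?C" for Z
      proof
        fix Z' assume Z': "Z' \<in> panel i Z"
        have Z: "Z \<in> flags" using that C by auto
        have Z'f: "Z' \<in> flags" using Z' panel_subset_flags[OF Z i] by auto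
        obtain Y where Y: "\<And>W'. W' \<in> panel i Z \<Longrightarrow> W' \<noteq> Y \<Longrightarrow> pos V W' = pos V Y \<circ> transpose i (i + 1)"
          using panel_pos[OF V Z i] by blast
        have "pos V Z = \<tau> \<or> pos V Z = \<tau>'" using that by (auto simp: schubert_cell_def)
        moreover have "pos V Z' = pos V Z \<or> pos V Z' = pos V Z \<circ> transpose i (i + 1)"
          using Y[OF Z'] Y[OF panel_self[OF Z]] by (cases "Z' = Y"; cases "Z = Y"; simp add: comp_assoc)
        ultimately have "pos V Z' = \<tau> \<or> pos V Z' = \<tau>'" using \<tau>\<tau>' \<tau>'_def by metis
        then show "Z' \<in> ?C" using Z'f by (auto simp: schubert_cell_def)
      qed
      have "\<tau> \<noteq> \<tau>'" using asc desc by auto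
      then have disj: "schubert_cell V \<tau> \<inter> schubert_cell V \<tau>' = {}" by (auto simp: schubert_cell_def)
      have "(\<Sum>W\<in>schubert_cell V \<tau>. f W) = - r * f V" if f: "f \<in> steinberg" for f
      proof -
        have "finite (schubert_cell V \<tau>)" "finite (schubert_cell V \<tau>')"
          using finite_flags by (auto simp: schubert_cell_def)
        then have "(\<Sum>W\<in>?C. f W) = (\<Sum>W\<in>schubert_cell V \<tau>. f W) + (\<Sum>W\<in>schubert_cell V \<tau>'. f W)"
          using disj by (rule sum.union_disjoint)
        then show ?thesis using steinberg_sum_eq_0[OF f i C closed] r f by auto
      qed
      then show ?thesis by blast
    qed
  qed
qed

text \<open>On each cell \<open>K V\<close> is constant, so the sum over all flags is a weighted sum
  of cell sums, each a fixed multiple of \<open>f V\<close>.\<close>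

lemma K_steinberg_eigen:
  assumes V: "V \<in> flags"
  shows "\<exists>c. \<forall>f\<in>steinberg. (\<Sum>W\<in>flags. K V W * f W) = c * f V"
proof -
  obtain r where r: "\<And>\<tau> f. f \<in> steinberg \<Longrightarrow> (\<Sum>W\<in>schubert_cell V \<tau>. f W) = r \<tau> * f V"
    using steinberg_sum_cell[OF V] by metis
  have "(\<Sum>W\<in>flags. K V W * f W) = (\<Sum>\<tau>\<in>pos V ` flags. \<kappa> ^ card (inversions \<tau>) * r \<tau>) * f V"
    if f: "f \<in> steinberg" for f
  proof -
    have "(\<Sum>W\<in>flags. K V W * f W) = (\<Sum>\<tau>\<in>pos V ` flags. \<Sum>W\<in>schubert_cell V \<tau>. K V W * f W)"
      unfolding schubert_cell_def by (rule sum.image_gen[OF finite_flags])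
    also have "\<dots> = (\<Sum>\<tau>\<in>pos V ` flags. \<kappa> ^ card (inversions \<tau>) * (\<Sum>W\<in>schubert_cell V \<tau>. f W))"
      unfolding sum_distrib_left
      by (intro sum.cong refl) (auto simp: schubert_cell_def K_eq[OF V])
    finally show ?thesis by (simp add: r[OF f] sum_distrib_right mult.assoc)
  qed
  then show ?thesis by blast
qed

text \<open>Every \<open>K U\<close> is a Steinberg function, which gives a factor
  \<open>c V\<close> that could still vary with \<open>V\<close>. Symmetry of both sides and
  nonvanishing of \<open>K\<close> make it constant.\<close>

lemma K_square: "\<exists>c>0. \<forall>V\<in>flags. \<forall>U\<in>flags. (\<Sum>W\<in>flags. K V W * K W U) = c * K V U"
proof -
  obtain c where c: "\<And>V f. V \<in> flags \<Longrightarrow> f \<in> steinberg \<Longrightarrow> (\<Sum>W\<in>flags. K V W * f W) = c V * f V"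
    using K_steinberg_eigen by metis
  have KK: "(\<Sum>W\<in>flags. K V W * K W U) = c V * K V U" if "V \<in> flags" "U \<in> flags" for V U
    using c[OF that(1) K_steinberg[OF that(2)]] by (simp add: K_commute[of _ U])
  have const: "c V = c U" if "V \<in> flags" "U \<in> flags" for V U
  proof -
    have "c V * K V U = c U * K U V"
      using KK[OF that] KK[OF that(2,1)] by (simp add: K_commute mult.commute)
    then show ?thesis using K_nonzero by (simp add: K_commute[of U V])
  qed
  \<comment> \<open>On the diagonal \<open>K V V = 1\<close>, so \<open>c V\<close> is the sum of
    the squares of the nonzero values \<open>K V W\<close>.\<close>
  have pos: "c V > 0" if V: "V \<in> flags" for V
  proof -
    have "inversions (pos V V) = {}" by (auto simp: inversions_def pos_self[OF V])
    then have "K V V = 1" using V by (simp add: K_eq)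
    then have "c V = (\<Sum>W\<in>flags. K V W * K W V)" using KK[OF V V] by simp
    also have "\<dots> = (\<Sum>W\<in>flags. (K V W)\<^sup>2)"
      by (intro sum.cong refl) (metis K_commute power2_eq_square)
    also have "\<dots> > 0" using finite_flags V K_nonzero by (intro sum_pos) auto
    finally show ?thesis .
  qed
  show ?thesis
  proof (cases "flags = {}")
    case False
    then obtain V0 where V0: "V0 \<in> flags" by auto
    have "(\<Sum>W\<in>flags. K V W * K W U) = c V0 * K V U" if "V \<in> flags" "U \<in> flags" for V U
      using KK[OF that] const[OF that(1) V0] by simp
    then show ?thesis using pos[OF V0] by blast
  qed (auto intro: exI[of _ 1])
qed

end

section \<open>The sequence space\<close>

lemma (in vectorspace) finite_imp_fin_dim:
  assumes "finite (carrier V)"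
  shows "fin_dim"
proof -
  have "span (carrier V) = carrier V"
    using in_own_span[of "carrier V"] span_is_subset2[of "carrier V"] by auto
  then show ?thesis using assms by (auto simp: fin_dim_def)
qed

text \<open>A basis of \<open>X\<close> together with \<open>x\<close> is linearly independent and
  has \<open>dim\<close> elements, so it is a basis of the whole space. This turns a dimension count
  into the exchange form of \<open>covers\<close>.\<close>

lemma (in vectorspace) hyperplane_exchange:
  assumes fin: "finite (carrier V)" and X: "VectorSpace.subspace K X V"
    and dim: "dim = Suc (vectorspace.dim K (V\<lparr>carrier := X\<rparr>))"
    and x: "x \<in> carrier V" "x \<notin> X" and y: "y \<in> carrier V"
  shows "\<exists>c\<in>carrier K. \<exists>b\<in>X. y = c \<odot>\<^bsub>V\<^esub> x \<oplus>\<^bsub>V\<^esub> b"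
proof -
  interpret X: vectorspace K "V\<lparr>carrier := X\<rparr>" by (rule subspace_is_vs[OF X])
  have sub: "submodule K X V" and XV: "X \<subseteq> carrier V"
    using X by (auto simp: VectorSpace.subspace_def submodule_def)
  have "X.fin_dim" by (rule X.finite_imp_fin_dim) (use fin XV finite_subset in auto)
  then obtain B where B: "finite B" "X.basis B" using X.finite_basis_exists by auto
  then have BX: "B \<subseteq> X" and "X.lin_indpt B" "X.span B = X" and card: "card B = X.dim"
    using X.dim_basis by (auto simp: X.basis_def)
  then have li: "lin_indpt B" and span: "span B = X"
    using span_li_not_depend[OF BX sub] by auto
  have BV: "B \<subseteq> carrier V" using BX XV by auto
  have xB: "x \<notin> B" using x BX by auto
  have li': "lin_indpt (B \<union> {x})"
    using lin_dep_iff_in_span[OF BV li x(1) xB] x(2) span by auto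
  have "card (B \<union> {x}) = dim" using B(1) xB card dim by simp
  then have "basis (B \<union> {x})"
    using dim_li_is_basis[OF finite_imp_fin_dim[OF fin]] B(1) BV x(1) li' by simp
  then have "y \<in> span (B \<union> {x})" using y by (simp add: basis_def)
  then obtain a where a: "a \<in> (B \<union> {x}) \<rightarrow> carrier K" "y = lincomb a (B \<union> {x})"
    using finite_span[of "B \<union> {x}"] B(1) BV x(1) by auto
  have "y = a x \<odot>\<^bsub>V\<^esub> x \<oplus>\<^bsub>V\<^esub> lincomb a B"
    using lincomb_insert[OF B(1) BV a(1) xB x(1)] a(2) by simp
  moreover have "lincomb a B \<in> X"
    unfolding span[symmetric] span_def using a(1) B(1) by blast
  ultimately show ?thesis using a(1) by auto
qed



definition seq_scale :: "'a::{finite, field} \<Rightarrow> (int \<Rightarrow> 'a) \<Rightarrow> int \<Rightarrow> 'a"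
  where "seq_scale c x = (\<lambda>k. c * x k)"

text \<open>The ambient space is that of all functions on the integers; the carrier of
  \<open>seq_space\<close> is a subspace of it that contains every term of a flag.\<close>

interpretation seq: finite_field_space seq_scale
  by unfold_locales (auto simp: seq_scale_def fun_eq_iff algebra_simps)

lemma carrier_seq_space: "carrier seq_space = {x. \<exists>N. \<forall>k>N. x k = 0}"
  by (simp add: seq_space_def)

lemma std_flag_eq: "std_flag j = {x. \<forall>k>j. x k = 0}"
  by (auto simp: std_flag_def carrier_seq_space)

lemma seq_space_simps:
  "\<zero>\<^bsub>seq_space\<^esub> = 0" "x \<oplus>\<^bsub>seq_space\<^esub> y = x + y" "c \<odot>\<^bsub>seq_space\<^esub> x = seq_scale c x"
  by (simp_all add: seq_space_def seq_scale_def fun_eq_iff)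

lemma subspace_seq_space:
  assumes "VectorSpace.subspace class_ring V seq_space"
  shows "seq.subspace V"
  using assms by (auto simp: VectorSpace.subspace_def submodule_def seq_space_simps seq.subspace_def)

lemma subspace_std_flag: "seq.subspace (std_flag j)"
  by (intro subspace_seq_space std_flag_subspace)

lemma std_flag_covers: "seq.covers (std_flag j :: (int \<Rightarrow> 'a::{finite, field}) set) (std_flag (j + 1))"
  unfolding seq.covers_def
proof (intro conjI)
  show "seq.subspace (std_flag j)" "seq.subspace (std_flag (j + 1))"
    by (rule subspace_std_flag)+
  show "std_flag j \<subseteq> std_flag (j + 1)" by (auto simp: std_flag_eq)
  let ?x = "\<lambda>k. if k = j + 1 then 1 else 0 :: 'a"
  show "\<exists>x\<in>(std_flag (j + 1) :: (int \<Rightarrow> 'a) set). x \<notin> std_flag j \<and> (\<forall>y\<in>std_flag (j + 1). \<exists>c. y - seq_scale c x \<in> std_flag j)"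
  proof (intro bexI[of _ ?x] conjI ballI)
    fix y :: "int \<Rightarrow> 'a" assume "y \<in> std_flag (j + 1)"
    then show "\<exists>c. y - seq_scale c ?x \<in> std_flag j"
      by (intro exI[of _ "y (j + 1)"]) (auto simp: std_flag_eq seq_scale_def)
  qed (auto simp: std_flag_eq)
qed

lemma std_flag_finite_quotient:
  "\<exists>T :: (int \<Rightarrow> 'a::{finite, field}) set. finite T \<and> (\<forall>x\<in>std_flag N. \<exists>t\<in>T. x - t \<in> std_flag M)"
proof (intro exI conjI ballI)
  \<comment> \<open>The representatives are the sequences supported in \<open>{M<..N}\<close>,
    written in the form that \<open>finite_set_of_finite_funs\<close> expects.\<close>
  let ?T = "{t :: int \<Rightarrow> 'a. \<forall>k. (k \<in> {M<..N} \<longrightarrow> t k \<in> UNIV) \<and> (k \<notin> {M<..N} \<longrightarrow> t k = 0)}"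
  show "finite ?T" by (rule finite_set_of_finite_funs) auto
  fix x :: "int \<Rightarrow> 'a" assume "x \<in> std_flag N"
  then show "\<exists>t\<in>?T. x - t \<in> std_flag M"
    by (intro bexI[of _ "\<lambda>k. if k \<in> {M<..N} then x k else 0"]) (auto simp: std_flag_eq)
qed

lemma flag_window_std_flag:
  "flag_window (seq_scale :: 'a::{finite, field} \<Rightarrow> _) std_flag M N"
  by (intro flag_window.intro seq.finite_field_space_axioms flag_window_axioms.intro std_flag_finite_quotient)

section \<open>Explicit coset arithmetic in the finite quotients\<close>

lemma flag_projection_eq: "flag_projection M N (x :: int \<Rightarrow> 'a::{finite, field}) = {e + x | e. e \<in> std_flag M}"
  by (auto simp: flag_projection_def a_r_coset_def' seq_space_simps)

lemma carrier_flag_quotient: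
  "carrier (flag_quotient M N) = flag_projection M N ` std_flag N"
  by (auto simp: flag_quotient_def quotient_space_def flag_projection_def A_RCOSETS_def RCOSETS_def a_r_coset_def)

lemma flag_projection_eq_iff:
  fixes x y :: "int \<Rightarrow> 'a::{finite, field}"
  shows "flag_projection M N x = flag_projection M N y \<longleftrightarrow> x - y \<in> std_flag M"
proof -
  note sub = subspace_std_flag[of M, where 'a = 'a]
  show ?thesis
  proof
    assume eq: "flag_projection M N x = flag_projection M N y"
    have "0 + x \<in> flag_projection M N x" using sub by (auto simp: flag_projection_eq seq.subspace_0)
    then obtain e where "e \<in> std_flag M" "x = e + y" by (auto simp: eq) (auto simp: flag_projection_eq)
    then show "x - y \<in> std_flag M" by simp
  next
    assume d: "x - y \<in> std_flag M"
    have *: "flag_projection M N x \<subseteq> flag_projection M N y" if "x - y \<in> std_flag M" for x y :: "int \<Rightarrow> 'a"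
    proof
      fix z assume "z \<in> flag_projection M N x"
      then obtain e where e: "e \<in> std_flag M" "z = e + x" by (auto simp: flag_projection_eq)
      then have "e + (x - y) \<in> std_flag M" using sub that seq.subspace_add by blast
      moreover have "z = (e + (x - y)) + y" using e by simp
      ultimately show "z \<in> flag_projection M N y" unfolding flag_projection_eq by blast
    qed
    have "y - x \<in> std_flag M" using seq.subspace_neg[OF sub d] by simp
    then show "flag_projection M N x = flag_projection M N y" using * d by blast
  qed
qed

lemma flag_projection_add:
  fixes x y :: "int \<Rightarrow> 'a::{finite, field}"
  assumes "x \<in> std_flag N" "y \<in> std_flag N"
  shows "flag_projection M N x \<oplus>\<^bsub>flag_quotient M N\<^esub> flag_projection M N y = flag_projection M N (x + y)"
proof -
  note sub = subspace_std_flag[of M, where 'a = 'a]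
  have "flag_projection M N x \<oplus>\<^bsub>flag_quotient M N\<^esub> flag_projection M N y
    = {a + b | a b. a \<in> flag_projection M N x \<and> b \<in> flag_projection M N y}"
    by (auto simp: flag_quotient_def quotient_space_def set_add_def' seq_space_simps)
  also have "\<dots> = flag_projection M N (x + y)"
  proof (intro equalityI subsetI)
    fix z assume "z \<in> {a + b | a b. a \<in> flag_projection M N x \<and> b \<in> flag_projection M N y}"
    then obtain e d where e: "e \<in> std_flag M" "d \<in> std_flag M" "z = (e + x) + (d + y)"
      by (auto simp: flag_projection_eq)
    then have "e + d \<in> std_flag M" "z = (e + d) + (x + y)" using seq.subspace_add[OF sub] by auto
    then show "z \<in> flag_projection M N (x + y)" unfolding flag_projection_eq by blast
  next
    fix z assume "z \<in> flag_projection M N (x + y)"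
    then obtain e where e: "e \<in> std_flag M" "z = e + (x + y)" by (auto simp: flag_projection_eq)
    then have "z = (e + x) + (0 + y)" by simp
    then show "z \<in> {a + b | a b. a \<in> flag_projection M N x \<and> b \<in> flag_projection M N y}"
      using e(1) seq.subspace_0[OF sub] unfolding flag_projection_eq by blast
  qed
  finally show ?thesis .
qed

lemma flag_projection_smult:
  fixes x :: "int \<Rightarrow> 'a::{finite, field}"
  shows "c \<odot>\<^bsub>flag_quotient M N\<^esub> flag_projection M N x = flag_projection M N (seq_scale c x)"
proof -
  note sub = subspace_std_flag[of M, where 'a = 'a]
  have 1: "c \<odot>\<^bsub>flag_quotient M N\<^esub> X = (\<Union>z\<in>X. flag_projection M N (seq_scale c z))" for X
    by (auto simp: flag_quotient_def quotient_space_def flag_projection_def seq_space_simps)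
  \<comment> \<open>All representatives of the coset give the same scaled coset, so the union
    defining scalar multiplication collapses.\<close>
  have "flag_projection M N (seq_scale c z) = flag_projection M N (seq_scale c x)"
    if "z \<in> flag_projection M N x" for z
    unfolding flag_projection_eq_iff seq.scale_right_diff_distrib[symmetric]
    using that seq.subspace_scale[OF sub] by (auto simp: flag_projection_eq)
  moreover have "x \<in> flag_projection M N x"
    using seq.subspace_0[OF sub] unfolding flag_projection_eq by force
  ultimately show ?thesis unfolding 1 by blast
qed

lemma finite_carrier_flag_quotient:
  "finite (carrier (flag_quotient M N) :: (int \<Rightarrow> 'a::{finite, field}) set set)"
proof -
  obtain T :: "(int \<Rightarrow> 'a) set" where T: "finite T" "\<forall>x\<in>std_flag N. \<exists>t\<in>T. x - t \<in> std_flag M"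
    using std_flag_finite_quotient by blast
  then have "flag_projection M N ` std_flag N \<subseteq> flag_projection M N ` T"
    using flag_projection_eq_iff by blast
  then show ?thesis unfolding carrier_flag_quotient using T(1) finite_subset by blast
qed

text \<open>Inside the window, consecutive terms of the finite flag differ by one dimension, so the
  smaller is a hyperplane in the larger; its exchange property lifts along the projection. Outside,
  the standard flag is already a chain.\<close>

lemma Fl_2inf_flags:
  assumes "V \<in> (Fl_2inf :: (int \<Rightarrow> (int \<Rightarrow> 'a::{finite, field}) set) set)"
  shows "\<exists>M N. seq.chain V \<and> (\<forall>j. j \<le> M \<or> N \<le> j \<longrightarrow> V j = std_flag j)"
proof -
  obtain M N F where sV: "\<And>j. VectorSpace.subspace class_ring (V j) seq_space" and MN: "M \<le> N"
    and out: "\<And>j. j \<le> M \<Longrightarrow> V j = std_flag j" "\<And>j. N \<le> j \<Longrightarrow> V j = std_flag j"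
    and F: "complete_flag class_ring (flag_quotient M N) (nat (N - M)) F"
    and VF: "\<And>\<alpha>. \<alpha> \<le> nat (N - M) \<Longrightarrow>
      V (M + int \<alpha>) = {x \<in> std_flag N. flag_projection M N x \<in> F \<alpha>}"
    using assms unfolding Fl_2inf_def by blast
  let ?Q = "flag_quotient M N :: ('a, (int \<Rightarrow> 'a) set) module"
  let ?\<pi> = "flag_projection M N :: (int \<Rightarrow> 'a) \<Rightarrow> _"
  interpret Q: vectorspace class_ring ?Q by (rule flag_quotient_vectorspace[OF MN])
  have "seq.covers (V j) (V (j + 1))" for j
  proof (cases "M \<le> j \<and> j < N")
    case False
    then have "V j = std_flag j" "V (j + 1) = std_flag (j + 1)" using out MN by auto
    then show ?thesis using std_flag_covers by simp
  next
    case True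
    define \<alpha> where "\<alpha> = nat (j - M)"
    have \<alpha>: "\<alpha> < nat (N - M)" using True by (simp add: \<alpha>_def)
    have j: "M + int \<alpha> = j" "M + int (Suc \<alpha>) = j + 1" using True by (auto simp: \<alpha>_def)
    have Vj: "V j = {x \<in> std_flag N. ?\<pi> x \<in> F \<alpha>}" "V (j + 1) = {x \<in> std_flag N. ?\<pi> x \<in> F (Suc \<alpha>)}"
      using VF[of \<alpha>] VF[of "Suc \<alpha>"] \<alpha> unfolding j by simp_all
    have sub: "VectorSpace.subspace class_ring (F \<alpha>) ?Q" "VectorSpace.subspace class_ring (F (Suc \<alpha>)) ?Q"
      and dim: "vectorspace.dim class_ring (?Q\<lparr>carrier := F \<alpha>\<rparr>) = \<alpha>"
        "vectorspace.dim class_ring (?Q\<lparr>carrier := F (Suc \<alpha>)\<rparr>) = Suc \<alpha>"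
      and FF: "F \<alpha> \<subseteq> F (Suc \<alpha>)"
      using F \<alpha> by (auto simp: complete_flag_def)
    let ?Y = "?Q\<lparr>carrier := F (Suc \<alpha>)\<rparr>"
    interpret Y: vectorspace class_ring ?Y by (rule Q.subspace_is_vs[OF sub(2)])
    have car: "F (Suc \<alpha>) \<subseteq> carrier ?Q" using sub by (auto simp: VectorSpace.subspace_def submodule_def)
    have finY: "finite (carrier ?Y)"
      using finite_subset[OF car finite_carrier_flag_quotient] by simp
    have subY: "VectorSpace.subspace class_ring (F \<alpha>) ?Y"
      using sub(1) FF Y.vectorspace_axioms Y.module_axioms
      by (auto simp: VectorSpace.subspace_def submodule_def)
    have dimY: "Y.dim = Suc (vectorspace.dim class_ring (?Y\<lparr>carrier := F \<alpha>\<rparr>))"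
      using dim by simp
    have "F \<alpha> \<noteq> F (Suc \<alpha>)" using dim by auto
    then obtain X where X: "X \<in> F (Suc \<alpha>)" "X \<notin> F \<alpha>" using FF by auto
    then obtain x where x: "x \<in> std_flag N" "X = ?\<pi> x" using car carrier_flag_quotient by blast
    note sN = subspace_std_flag[of N, where 'a = 'a]
    show ?thesis unfolding seq.covers_def
    proof (intro conjI bexI[of _ x] ballI)
      show "seq.subspace (V j)" "seq.subspace (V (j + 1))" using sV subspace_seq_space by auto
      show "V j \<subseteq> V (j + 1)" "x \<in> V (j + 1)" "x \<notin> V j" using Vj FF X x by auto
      fix y assume "y \<in> V (j + 1)"
      then have y: "y \<in> std_flag N" "?\<pi> y \<in> F (Suc \<alpha>)" using Vj by auto
      \<comment> \<open>Decompose in the quotient and lift: modulo \<open>E M\<close> the vector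
        \<open>y\<close> is \<open>seq_scale c x\<close> plus a lift of \<open>B\<close>, so
        \<open>y - seq_scale c x\<close> projects into \<open>F \<alpha>\<close>.\<close>
      obtain c B where B: "B \<in> F \<alpha>" and eq: "?\<pi> y = c \<odot>\<^bsub>?Q\<^esub> ?\<pi> x \<oplus>\<^bsub>?Q\<^esub> B"
        using Y.hyperplane_exchange[OF finY subY dimY, of X "?\<pi> y"] X x y by auto
      obtain b where b: "b \<in> std_flag N" "B = ?\<pi> b" using B FF car carrier_flag_quotient by blast
      have cx: "seq_scale c x \<in> std_flag N" using seq.subspace_scale[OF sN x(1)] .
      have "?\<pi> y = ?\<pi> (seq_scale c x + b)"
        using eq b cx by (simp add: flag_projection_smult flag_projection_add)
      then have "y - (seq_scale c x + b) \<in> std_flag M" by (simp add: flag_projection_eq_iff)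
      then have "?\<pi> (y - seq_scale c x) = B" by (simp add: b flag_projection_eq_iff diff_diff_eq)
      then have "y - seq_scale c x \<in> V j"
        using B Vj seq.subspace_diff[OF sN y(1) cx] by simp
      then show "\<exists>c. y - seq_scale c x \<in> V j" by blast
    qed
  qed
  then show ?thesis using out unfolding seq.chain_def by blast
qed

theorem mainTheorem5:
  "positive_definite_kernel
     (Fl_2inf :: (int \<Rightarrow> (int \<Rightarrow> 'a::{finite, field}) set) set) flag_kernel"
  unfolding positive_definite_kernel_def
proof (intro allI impI)
  fix n and v :: "nat \<Rightarrow> int \<Rightarrow> (int \<Rightarrow> 'a) set"
  assume "\<forall>i<n. v i \<in> Fl_2inf"
  then have "\<forall>i. \<exists>M N. i < n \<longrightarrow> seq.chain (v i) \<and> (\<forall>j. j \<le> M \<or> N \<le> j \<longrightarrow> v i j = std_flag j)"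
    using Fl_2inf_flags by blast
  then obtain M N where MN: "\<And>i. i < n \<Longrightarrow> seq.chain (v i)"
    "\<And>i j. i < n \<Longrightarrow> j \<le> M i \<or> N i \<le> j \<Longrightarrow> v i j = std_flag j" by metis
  \<comment> \<open>One window serves all the flags. Inserting 0 keeps the minimum and maximum
    meaningful when \<open>n = 0\<close>.\<close>
  define M0 N0 where "M0 = Min (insert 0 (M ` {..<n}))" and "N0 = Max (insert 0 (N ` {..<n}))"
  have le: "M0 \<le> M i" "N i \<le> N0" if "i < n" for i
    using that by (auto simp: M0_def N0_def)
  interpret flag_window "seq_scale :: 'a \<Rightarrow> _" std_flag M0 N0
    by (rule flag_window_std_flag)
  have v: "v i \<in> flags" if "i < n" for i
    using MN[OF that] le[OF that] by (fastforce simp: flags_def)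
  obtain c where c: "c > 0" "\<And>V U. V \<in> flags \<Longrightarrow> U \<in> flags \<Longrightarrow> (\<Sum>W\<in>flags. K V W * K W U) = c * K V U"
    using K_square by blast
  \<comment> \<open>Both sides are the same power of \<kappa>, since \<open>- q\<close> to the power
    \<open>- k\<close> is the \<open>k\<close>-th power of its inverse.\<close>
  have "flag_kernel = K"
    by (simp add: fun_eq_iff flag_kernel_def K_def \<kappa>_def power_int_minus power_inverse[symmetric] divide_inverse)
  then show "0 \<le> det (mat n n (\<lambda>(i, j). flag_kernel (v i) (v j)))"
    using det_nonneg_of_reproducing_kernel[OF finite_flags c(1) K_commute c(2) v] by simp
qed

end
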